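(* Let $\Gamma=(X,\mathcal E)$ be the 3-cube (the distance-regular graph with $8$ vertices and intersection array $\{3,2,1;1,2,3\}$); the spectrum of its adjacency matrix $A$ is $3^11^3(-1)^3(-3)^1$. Let $x\in X$, $T=T(x)$, and fix any ordering of the three vertices of $\Gamma_1(x)$. Then the standard module $V=\mathbb C^X$ is an orthogonal direct sum of irreducible $T$-modules $V=W_0\oplus W_{1,a}\oplus W_{1,b}$, where two summands are isomorphic if and only if they have the same type in the following list, and the data are as listed. Each listed basis is a pure basis of the module. For each summand other than $W_0$, the seed vector $\nu$ spans $E_r^*W$ (so $\dim E_r^*W=1$), where $r$ is the endpoint of the summand $W$, and is given by its essential part. Type I ($W_0$): endpoint 0, multiplicity 1, dimension 4, diameter 3, shape $(1,1,1,1)$; basis $e_0^*,e_1^*,e_2^*,e_3^*$; matrix representing $A$: $\begin{pmatrix}0&3&0&0\\1&0&2&0\\0&2&0&1\\0&0&3&0\end{pmatrix}$, with eigenvalues $3,1,-1,-3$. Type II ($W_{1,a},W_{1,b}$): endpoint 1, multiplicity 2, dimension 2, diameter 1, shape $(1,1)$; basis $\nu,A\nu$ (with $A\nu=E_2^*A\nu$), where $\nu=[1,-1,0]$ for $W_{1,a}$ and $\nu=[1,1,-2]$ for $W_{1,b}$; matrix representing $A$: $\begin{pmatrix}0&1\\1&0\end{pmatrix}$, with eigenvalues $1,-1$. Moreover $\dim T=4^2+2^2=20$.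
   Context: Let $\Gamma=(X,\mathcal E)$ be a finite undirected connected graph without loops or multiple edges, with path-length distance $d$ and diameter $D\ge1$; put $\Gamma_i(x)=\{y\in X:d(x,y)=i\}$. $\Gamma$ is distance-regular if for all $0\le h,i,j\le D$ the number $p^h_{i,j}=|\Gamma_i(y)\cap\Gamma_j(z)|$ is the same for all $y,z\in X$ with $d(y,z)=h$. Its intersection array is $\{b_0,\dots,b_{D-1};c_1,\dots,c_D\}$ with $b_i=p^i_{1,i+1}$, $c_i=p^i_{1,i-1}$. $A\in\mathrm{Mat}_X(\mathbb C)$ is the adjacency matrix; in its spectrum, exponents denote multiplicities. The standard module $V=\mathbb C^X$ (column vectors) carries the Hermitian inner product $\langle u,v\rangle=u^t\bar v$. Fix a base vertex $x\in X$. For $0\le i\le D$, $E_i^*=E_i^*(x)$ is the diagonal matrix with $(y,y)$-entry $1$ if $d(x,y)=i$ and $0$ otherwise, and $e_i^*\in V$ is the vector with $y$-entry $1$ if $d(x,y)=i$ and $0$ otherwise. The Terwilliger algebra $T=T(x)$ is the subalgebra of $\mathrm{Mat}_X(\mathbb C)$ generated by $A$ and $E_0^*,\dots,E_D^*$. A $T$-module is a subspace $W\subseteq V$ with $BW\subseteq W$ for all $B\in T$; it is irreducible if $W\ne0$ and it properly contains no nonzero $T$-module. Isomorphisms of $T$-modules are vector space isomorphisms commuting with every $B\in T$. The endpoint of $W$ is $r=\min\{i:E_i^*W\ne0\}$; the diameter of an irreducible $W$ is $\delta=|\{i:E_i^*W\ne0\}|-1$, and its shape is $(\dim E_r^*W,\dots,\dim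 E_{r+\delta}^*W)$. The multiplicity of an irreducible module is the number of summands isomorphic to it in an orthogonal decomposition of $V$ into irreducible $T$-modules. A nonzero vector is pure with support $i$ if it lies in $E_i^*V$; its essential part is the row vector of its coordinates at the vertices of $\Gamma_i(x)$ (all its other coordinates are $0$). A pure basis of an irreducible $T$-module is an ordered basis of pure vectors with weakly increasing supports. The matrix $B$ representing $A$ with respect to a basis $v_1,\dots,v_\ell$ is given by $Av_j=\sum_iB_{ij}v_i$. *)

theory Defs
  imports "HOL-Analysis.Analysis"
begin

subsection \<open>Distance-regular graphs\<close>

text \<open>The vertex set X is the (finite, nonempty) type of vertices. A graph without loops and
  multiple edges is given by its adjacency relation.\<close>

definition connected_simple_graph :: "('v::finite \<Rightarrow> 'v \<Rightarrow> bool) \<Rightarrow> bool" where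
  "connected_simple_graph adj \<longleftrightarrow> symp adj \<and> irreflp adj \<and> (\<forall>u v. adj\<^sup>*\<^sup>* u v)"

text \<open>Length of a shortest walk, hence of a shortest path; only meaningful for connected graphs.\<close>

definition gdist :: "('v \<Rightarrow> 'v \<Rightarrow> bool) \<Rightarrow> 'v \<Rightarrow> 'v \<Rightarrow> nat" where
  "gdist adj u v = (LEAST n. (adj ^^ n) u v)"

definition gdiameter :: "('v::finite \<Rightarrow> 'v \<Rightarrow> bool) \<Rightarrow> nat" where
  "gdiameter adj = Max {gdist adj u v | u v. True}"

definition layer :: "('v \<Rightarrow> 'v \<Rightarrow> bool) \<Rightarrow> 'v \<Rightarrow> nat \<Rightarrow> 'v set" where
  "layer adj x i = {y. gdist adj x y = i}"

definition distance_regular :: "('v::finite \<Rightarrow> 'v \<Rightarrow> bool) \<Rightarrow> bool" where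
  "distance_regular adj \<longleftrightarrow>
     (\<forall>h i j. h \<le> gdiameter adj \<and> i \<le> gdiameter adj \<and> j \<le> gdiameter adj \<longrightarrow>
        (\<exists>p. \<forall>y z. gdist adj y z = h \<longrightarrow> card (layer adj y i \<inter> layer adj z j) = p))"

text \<open>The value is unique if the graph is distance-regular and h, i, j are at most the diameter,
  because then some pair of vertices is at distance h.\<close>

definition intersection_number :: "('v \<Rightarrow> 'v \<Rightarrow> bool) \<Rightarrow> nat \<Rightarrow> nat \<Rightarrow> nat \<Rightarrow> nat" where
  "intersection_number adj h i j =
     (THE p. \<forall>y z. gdist adj y z = h \<longrightarrow> card (layer adj y i \<inter> layer adj z j) = p)"

text \<open>The lists of the numbers b0, ..., b(D-1) and c1, ..., cD.\<close>

definition intersection_array :: "('v::finite \<Rightarrow> 'v \<Rightarrow> bool) \<Rightarrow> nat list \<times> nat list" where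
  "intersection_array adj =
     (map (\<lambda>i. intersection_number adj i 1 (i + 1)) [0..<gdiameter adj],
      map (\<lambda>i. intersection_number adj i 1 (i - 1)) [1..<gdiameter adj + 1])"

definition cube_adj :: "bool^3 \<Rightarrow> bool^3 \<Rightarrow> bool" where
  "cube_adj u v \<longleftrightarrow> card {i. u $ i \<noteq> v $ i} = 1"

definition is_3cube :: "('v \<Rightarrow> 'v \<Rightarrow> bool) \<Rightarrow> bool" where
  "is_3cube adj \<longleftrightarrow> (\<exists>f. bij f \<and> (\<forall>u v. adj u v \<longleftrightarrow> cube_adj (f u) (f v)))"

subsection \<open>Complex vectors and matrices\<close>

text \<open>On complex vectors, all linear algebra must use the vector space structure
  \<^term>\<open>(*s)\<close> (constants prefixed by vec), since the unprefixed span, dim, subspace are those of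
  real vector spaces.\<close>

definition herm_inner :: "complex^'v \<Rightarrow> complex^'v \<Rightarrow> complex" where
  "herm_inner u v = (\<Sum>y\<in>UNIV. u $ y * cnj (v $ y))"

definition eigenspace :: "complex^'n^'n \<Rightarrow> complex \<Rightarrow> (complex^'n) set" where
  "eigenspace M \<theta> = {v. M *v v = \<theta> *s v}"

definition eigenvalues :: "complex^'n^'n \<Rightarrow> complex set" where
  "eigenvalues M = {\<theta>. \<exists>v. v \<noteq> 0 \<and> M *v v = \<theta> *s v}"

text \<open>Eigenvalues paired with the dimensions of their eigenspaces. It is applied to Hermitian
  matrices, where these coincide with the algebraic multiplicities.\<close>

definition spectrum :: "complex^'n^'n \<Rightarrow> (complex \<times> nat) set" where
  "spectrum M = {(\<theta>, vec.dim (eigenspace M \<theta>)) | \<theta>. \<theta> \<in> eigenvalues M}"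

definition is_basis :: "(complex^'v) list \<Rightarrow> (complex^'v) set \<Rightarrow> bool" where
  "is_basis vs W \<longleftrightarrow> distinct vs \<and> vec.independent (set vs) \<and> vec.span (set vs) = W"

text \<open>The indices 1, ..., n of a matrix of size n are read in the numeral type n, in which n
  and 0 coincide; this is the convention of \<^const>\<open>vector\<close>.\<close>

definition represents :: "complex^'v^'v \<Rightarrow> (complex^'v) list \<Rightarrow>
    complex^'n::{finite,semiring_1}^'n::{finite,semiring_1} \<Rightarrow> bool" where
  "represents M vs B \<longleftrightarrow> length vs = CARD('n) \<and>
     (\<forall>j\<in>{1..length vs}.
        M *v (vs ! (j - 1)) = (\<Sum>i = 1..length vs. (B $ of_nat i $ of_nat j) *s (vs ! (i - 1))))"

text \<open>The complex vector space of matrices; \<^term>\<open>(*s)\<close> does not provide it, its scalars for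
  matrices being vectors.\<close>

definition smult_matrix :: "complex \<Rightarrow> complex^'n^'m \<Rightarrow> complex^'n^'m" where
  "smult_matrix c M = map_matrix ((*) c) M"

global_interpretation cmat: vector_space "smult_matrix :: complex \<Rightarrow> complex^'n^'m \<Rightarrow> complex^'n^'m"
  by unfold_locales (simp_all add: smult_matrix_def vec_eq_iff algebra_simps)

definition matrix_subalgebra :: "(complex^'v^'v) set \<Rightarrow> bool" where
  "matrix_subalgebra S \<longleftrightarrow> cmat.subspace S \<and> mat 1 \<in> S \<and> (\<forall>M\<in>S. \<forall>N\<in>S. M ** N \<in> S)"

subsection \<open>The Terwilliger algebra and its modules\<close>

definition adjacency_matrix :: "('v \<Rightarrow> 'v \<Rightarrow> bool) \<Rightarrow> complex^'v^'v" where
  "adjacency_matrix adj = (\<chi> u v. if adj u v then 1 else 0)"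

definition dual_idempotent :: "('v \<Rightarrow> 'v \<Rightarrow> bool) \<Rightarrow> 'v \<Rightarrow> nat \<Rightarrow> complex^'v^'v" where
  "dual_idempotent adj x i = (\<chi> y z. if y = z \<and> gdist adj x y = i then 1 else 0)"

definition layer_vector :: "('v \<Rightarrow> 'v \<Rightarrow> bool) \<Rightarrow> 'v \<Rightarrow> nat \<Rightarrow> complex^'v" where
  "layer_vector adj x i = (\<chi> y. if gdist adj x y = i then 1 else 0)"

definition terwilliger_algebra :: "('v::finite \<Rightarrow> 'v \<Rightarrow> bool) \<Rightarrow> 'v \<Rightarrow> (complex^'v^'v) set" where
  "terwilliger_algebra adj x =
     matrix_subalgebra hull
       (insert (adjacency_matrix adj) (dual_idempotent adj x ` {0..gdiameter adj}))"

definition T_module :: "('v::finite \<Rightarrow> 'v \<Rightarrow> bool) \<Rightarrow> 'v \<Rightarrow> (complex^'v) set \<Rightarrow> bool" where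
  "T_module adj x W \<longleftrightarrow>
     vec.subspace W \<and> (\<forall>B\<in>terwilliger_algebra adj x. \<forall>w\<in>W. B *v w \<in> W)"

definition irreducible_T_module :: "('v::finite \<Rightarrow> 'v \<Rightarrow> bool) \<Rightarrow> 'v \<Rightarrow> (complex^'v) set \<Rightarrow> bool" where
  "irreducible_T_module adj x W \<longleftrightarrow>
     T_module adj x W \<and> W \<noteq> {0} \<and> (\<forall>U. T_module adj x U \<and> U \<subset> W \<longrightarrow> U = {0})"

definition T_isomorphic ::
    "('v::finite \<Rightarrow> 'v \<Rightarrow> bool) \<Rightarrow> 'v \<Rightarrow> (complex^'v) set \<Rightarrow> (complex^'v) set \<Rightarrow> bool" where
  "T_isomorphic adj x U W \<longleftrightarrow>
     (\<exists>f. bij_betw f U W \<and>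
          (\<forall>u\<in>U. \<forall>v\<in>U. f (u + v) = f u + f v) \<and>
          (\<forall>c. \<forall>u\<in>U. f (c *s u) = c *s f u) \<and>
          (\<forall>B\<in>terwilliger_algebra adj x. \<forall>u\<in>U. f (B *v u) = B *v f u))"

text \<open>Orthogonal decompositions of the whole space into irreducible modules. The sum is
  automatically direct, because the Hermitian inner product is definite.\<close>

definition orthogonal_decomposition ::
    "('v::finite \<Rightarrow> 'v \<Rightarrow> bool) \<Rightarrow> 'v \<Rightarrow> (complex^'v) set set \<Rightarrow> bool" where
  "orthogonal_decomposition adj x \<W> \<longleftrightarrow>
     finite \<W> \<and>
     (\<forall>W\<in>\<W>. irreducible_T_module adj x W) \<and>
     (\<forall>U\<in>\<W>. \<forall>W\<in>\<W>. U \<noteq> W \<longrightarrow> (\<forall>u\<in>U. \<forall>w\<in>W. herm_inner u w = 0)) \<and>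
     {\<Sum>W\<in>\<W>. g W | g. \<forall>W\<in>\<W>. g W \<in> W} = UNIV"

text \<open>A definite description, so that a statement about its value includes the independence of
  the chosen decomposition.\<close>

definition multiplicity_of :: "('v::finite \<Rightarrow> 'v \<Rightarrow> bool) \<Rightarrow> 'v \<Rightarrow> (complex^'v) set \<Rightarrow> nat" where
  "multiplicity_of adj x W =
     (THE m. \<exists>\<W>. orthogonal_decomposition adj x \<W> \<and> card {U \<in> \<W>. T_isomorphic adj x U W} = m)"

definition module_layer ::
    "('v \<Rightarrow> 'v \<Rightarrow> bool) \<Rightarrow> 'v \<Rightarrow> (complex^'v) set \<Rightarrow> nat \<Rightarrow> (complex^'v) set" where
  "module_layer adj x W i = (*v) (dual_idempotent adj x i) ` W"

definition module_support ::
    "('v::finite \<Rightarrow> 'v \<Rightarrow> bool) \<Rightarrow> 'v \<Rightarrow> (complex^'v) set \<Rightarrow> nat set" where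
  "module_support adj x W = {i. i \<le> gdiameter adj \<and> module_layer adj x W i \<noteq> {0}}"

definition endpoint :: "('v::finite \<Rightarrow> 'v \<Rightarrow> bool) \<Rightarrow> 'v \<Rightarrow> (complex^'v) set \<Rightarrow> nat" where
  "endpoint adj x W = Min (module_support adj x W)"

definition module_diameter :: "('v::finite \<Rightarrow> 'v \<Rightarrow> bool) \<Rightarrow> 'v \<Rightarrow> (complex^'v) set \<Rightarrow> nat" where
  "module_diameter adj x W = card (module_support adj x W) - 1"

definition shape :: "('v::finite \<Rightarrow> 'v \<Rightarrow> bool) \<Rightarrow> 'v \<Rightarrow> (complex^'v) set \<Rightarrow> nat list" where
  "shape adj x W =
     map (\<lambda>i. vec.dim (module_layer adj x W i))
       [endpoint adj x W ..< endpoint adj x W + module_diameter adj x W + 1]"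

definition pure_vector :: "('v::finite \<Rightarrow> 'v \<Rightarrow> bool) \<Rightarrow> 'v \<Rightarrow> nat \<Rightarrow> complex^'v \<Rightarrow> bool" where
  "pure_vector adj x i v \<longleftrightarrow> v \<noteq> 0 \<and> v \<in> module_layer adj x UNIV i"

text \<open>Here ys is an ordering of the vertices of the layer supporting v.\<close>

definition essential_part :: "'v list \<Rightarrow> complex^'v \<Rightarrow> complex list" where
  "essential_part ys v = map (\<lambda>y. v $ y) ys"

definition pure_basis ::
    "('v::finite \<Rightarrow> 'v \<Rightarrow> bool) \<Rightarrow> 'v \<Rightarrow> (complex^'v) list \<Rightarrow> (complex^'v) set \<Rightarrow> bool" where
  "pure_basis adj x vs W \<longleftrightarrow>
     is_basis vs W \<and> (\<exists>is. sorted is \<and> list_all2 (pure_vector adj x) is vs)"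

end

(* The axioms on the array only enter through: valency 3, no triangles, two common neighbours at
   distance two, eight vertices. They force the edges to be those of the cube, with any prescribed
   order of the neighbours of x, so everything else happens in a graph with eight named vertices.

   A vector of the first layer with coordinate sum 0 and its image under A span an irreducible module,
   on which A swaps the two vectors. Any irreducible summand of an orthogonal decomposition either
   contains the all-ones vectors of the layers or is orthogonal to them and hence of this second kind.
   The first layers of the summands are pairwise orthogonal lines filling a space of dimension three,
   which gives the multiplicities.

   The algebra T consists of the matrices whose (p,q) entry depends only on the three distances between
   x, p and q. They belong to T, since E_i^* A_k E_j^* does and the distance matrices A_k are polynomials
   in A; conversely, the automorphisms of the cube fixing x leave T invariant and act transitively on the
   pairs (p,q) with given distances. There are 20 triples of distances. *)

theory Submission
  imports Defs
begin

subsection \<open>Distances and distance-regularity\<close>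

text \<open>Three features of the statement shape the proof. The seeds have prescribed coordinates
  in an arbitrary order of the first layer. An isomorphism with the model cube does not control that
  order, whereas the array lets the cube be rebuilt outwards from \<open>x\<close> with its
  neighbours already named. The multiplicity is a definite description over all orthogonal
  decompositions, so exhibiting one of them is not enough: the count must be shown to be the same in
  each. Intersection numbers are definite descriptions too, so evaluating one requires an actual
  pair of vertices at the given distance.\<close>

lemma gdist_unique:
  fixes d :: "'v \<Rightarrow> nat"
  assumes zero: "d u = 0"
    and step: "\<And>v v'. adj v v' \<Longrightarrow> d v' \<le> Suc (d v)"
    and pred: "\<And>v. v \<noteq> u \<Longrightarrow> \<exists>v'. adj v' v \<and> d v = Suc (d v')"
  shows "gdist adj u v = d v"
proof -
  \<comment> \<open>Along a walk from \<open>u\<close> the value of \<open>d\<close> grows by at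
    most one per edge, and \<open>pred\<close> descends from any vertex to \<open>u\<close>; so
    local conditions alone identify \<open>d\<close> with the distance.\<close>
  have le: "d v \<le> n" if "(adj ^^ n) u v" for n v
    using that
  proof (induction n arbitrary: v)
    case 0
    then show ?case using zero by auto
  next
    case (Suc n)
    then obtain v' where "(adj ^^ n) u v'" "adj v' v" by auto
    then show ?case using Suc.IH step[of v' v] by fastforce
  qed
  have reach: "(adj ^^ n) u v" if "d v = n" for n v
    using that
  proof (induction n arbitrary: v)
    case 0
    then show ?case using pred[of v] by auto
  next
    case (Suc n)
    then have "v \<noteq> u" using zero by auto
    then obtain v' where "adj v' v" "d v = Suc (d v')" using pred by blast
    then show ?case using Suc by auto
  qed
  show ?thesis
    unfolding gdist_def using le reach by (intro Least_equality) auto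
qed

lemma gdist_self: "gdist adj u u = 0"
  unfolding gdist_def by (rule Least_eq_0) simp

lemma gdist_relpow:
  assumes "connected_simple_graph adj"
  shows "(adj ^^ gdist adj u v) u v"
proof -
  have "\<exists>n. (adj ^^ n) u v"
    using assms rtranclp_power unfolding connected_simple_graph_def by metis
  then show ?thesis unfolding gdist_def by (rule LeastI_ex)
qed

lemma gdist_le: "(adj ^^ n) u v \<Longrightarrow> gdist adj u v \<le> n"
  unfolding gdist_def by (rule Least_le)

lemma gdist_eq_0_iff:
  assumes "connected_simple_graph adj"
  shows "gdist adj u v = 0 \<longleftrightarrow> u = v"
  using gdist_relpow[OF assms, of u v] by (auto simp: gdist_self)

lemma gdist_eq_1_iff:
  assumes "connected_simple_graph adj"
  shows "gdist adj u v = 1 \<longleftrightarrow> adj u v"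
proof
  assume "gdist adj u v = 1"
  then show "adj u v" using gdist_relpow[OF assms, of u v] by auto
next
  assume "adj u v"
  then have "u \<noteq> v" "gdist adj u v \<le> 1"
    using assms gdist_le[of 1 adj u v]
    by (auto simp: connected_simple_graph_def irreflp_def)
  then show "gdist adj u v = 1" using gdist_eq_0_iff[OF assms, of u v] by linarith
qed

lemma gdist_eq_2I:
  assumes "connected_simple_graph adj" "adj u w" "adj w v" "u \<noteq> v" "\<not> adj u v"
  shows "gdist adj u v = 2"
proof -
  have "(adj ^^ 2) u v" using assms by (auto simp: numeral_2_eq_2)
  then have "gdist adj u v \<le> 2" by (rule gdist_le)
  then show ?thesis
    using assms gdist_eq_0_iff[of adj u v] gdist_eq_1_iff[of adj u v] by linarith
qed

lemma gdist_le_diameter: "gdist adj u v \<le> gdiameter adj"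
proof -
  have "finite ((\<lambda>(u, v). gdist adj u v) ` UNIV)" by simp
  also have "(\<lambda>(u, v). gdist adj u v) ` UNIV = {gdist adj u v | u v. True}" by auto
  finally show ?thesis unfolding gdiameter_def by (intro Max_ge) auto
qed

lemma gdiameter_attained: "\<exists>u v. gdist adj u v = gdiameter adj"
proof -
  have "finite ((\<lambda>(u, v). gdist adj u v) ` UNIV)" by simp
  also have "(\<lambda>(u, v). gdist adj u v) ` UNIV = {gdist adj u v | u v. True}" by auto
  finally have "gdiameter adj \<in> {gdist adj u v | u v. True}"
    unfolding gdiameter_def by (intro Max_in) auto
  then show ?thesis by force
qed

text \<open>The pair \<open>y\<close>, \<open>z\<close> pins down the definite description: if no
  vertices were at distance \<open>h\<close>, every \<open>p\<close> would satisfy it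
  vacuously.\<close>

lemma intersection_number_card:
  assumes "distance_regular adj" "h \<le> gdiameter adj" "i \<le> gdiameter adj" "j \<le> gdiameter adj"
    and "gdist adj y z = h"
  shows "card (layer adj y i \<inter> layer adj z j) = intersection_number adj h i j"
proof -
  obtain p where p: "\<forall>y z. gdist adj y z = h \<longrightarrow> card (layer adj y i \<inter> layer adj z j) = p"
    using assms unfolding distance_regular_def by blast
  have "intersection_number adj h i j = p"
    unfolding intersection_number_def using p assms(5) by (intro the_equality) auto
  then show ?thesis using p assms(5) by auto
qed

section \<open>The cube with eight named vertices\<close>

definition cube_edges :: "'v \<Rightarrow> 'v \<Rightarrow> 'v \<Rightarrow> 'v \<Rightarrow> 'v \<Rightarrow> 'v \<Rightarrow> 'v \<Rightarrow> 'v \<Rightarrow> ('v \<times> 'v) set" where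
  "cube_edges x y1 y2 y3 z1 z2 z3 w =
    {(x, y1), (x, y2), (x, y3), (y1, z2), (y1, z3), (y2, z1), (y2, z3), (y3, z1), (y3, z2),
     (z1, w), (z2, w), (z3, w)}"

text \<open>The vertex \<open>z1\<close> is the antipode of \<open>y1\<close>, likewise for the
  other indices, and \<open>w\<close> is the antipode of \<open>x\<close>. Edges are listed once,
  directed away from \<open>x\<close>, which is why membership is tested in both
  orientations.\<close>

locale labelled_cube =
  fixes adj :: "'v::finite \<Rightarrow> 'v \<Rightarrow> bool" and x y1 y2 y3 z1 z2 z3 w :: 'v
  assumes distinct_vertices: "distinct [x, y1, y2, y3, z1, z2, z3, w]"
    and vertices: "UNIV = {x, y1, y2, y3, z1, z2, z3, w}"
    and adj_iff: "adj u v \<longleftrightarrow> (u, v) \<in> cube_edges x y1 y2 y3 z1 z2 z3 w \<or> (v, u) \<in> cube_edges x y1 y2 y3 z1 z2 z3 w"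
begin

lemma neqs' [simp]:
  "x \<noteq> y1" "x \<noteq> y2" "x \<noteq> y3" "x \<noteq> z1" "x \<noteq> z2" "x \<noteq> z3" "x \<noteq> w"
  "y1 \<noteq> y2" "y1 \<noteq> y3" "y1 \<noteq> z1" "y1 \<noteq> z2" "y1 \<noteq> z3" "y1 \<noteq> w"
  "y2 \<noteq> y3" "y2 \<noteq> z1" "y2 \<noteq> z2" "y2 \<noteq> z3" "y2 \<noteq> w"
  "y3 \<noteq> z1" "y3 \<noteq> z2" "y3 \<noteq> z3" "y3 \<noteq> w"
  "z1 \<noteq> z2" "z1 \<noteq> z3" "z1 \<noteq> w" "z2 \<noteq> z3" "z2 \<noteq> w" "z3 \<noteq> w"
  using distinct_vertices by auto

lemmas neqs_sym [simp] = neqs'[symmetric]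

lemma all_vertices: "(\<forall>u. P u) \<longleftrightarrow> P x \<and> P y1 \<and> P y2 \<and> P y3 \<and> P z1 \<and> P z2 \<and> P z3 \<and> P w"
proof -
  have "(\<forall>u. P u) \<longleftrightarrow> (\<forall>u\<in>UNIV. P u)" by simp
  then show ?thesis unfolding vertices by simp
qed

lemma ex_vertices: "(\<exists>u. P u) \<longleftrightarrow> P x \<or> P y1 \<or> P y2 \<or> P y3 \<or> P z1 \<or> P z2 \<or> P z3 \<or> P w"
  using all_vertices[of "\<lambda>u. \<not> P u"] by blast

lemma sum_vertices: "(\<Sum>u\<in>UNIV. f u) = f x + f y1 + f y2 + f y3 + f z1 + f z2 + f z3 + f w"
  for f :: "'v \<Rightarrow> 'a::comm_monoid_add"
  unfolding vertices by (simp add: add.assoc)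

lemma card_UNIV: "CARD('v) = 8"
  unfolding vertices by simp

text \<open>Coordinates of the cube with \<open>x\<close> at the origin: \<open>y1\<close>,
  \<open>y2\<close>, \<open>y3\<close> are the unit vectors, and each \<open>z\<close> is the
  complement of the \<open>y\<close> with the same index. Then \<open>ham\<close> is the Hamming
  distance, which turns distances into arithmetic on bits.\<close>

definition bit1 :: "'v \<Rightarrow> bool" where "bit1 u \<longleftrightarrow> u \<in> {y1, z2, z3, w}"
definition bit2 :: "'v \<Rightarrow> bool" where "bit2 u \<longleftrightarrow> u \<in> {y2, z1, z3, w}"
definition bit3 :: "'v \<Rightarrow> bool" where "bit3 u \<longleftrightarrow> u \<in> {y3, z1, z2, w}"

definition ham :: "'v \<Rightarrow> 'v \<Rightarrow> nat" where
  "ham u v = of_bool (bit1 u \<noteq> bit1 v) + of_bool (bit2 u \<noteq> bit2 v) + of_bool (bit3 u \<noteq> bit3 v)"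

lemma bits:
  "\<not> bit1 x" "\<not> bit2 x" "\<not> bit3 x"
  "bit1 y1" "\<not> bit2 y1" "\<not> bit3 y1"
  "\<not> bit1 y2" "bit2 y2" "\<not> bit3 y2"
  "\<not> bit1 y3" "\<not> bit2 y3" "bit3 y3"
  "\<not> bit1 z1" "bit2 z1" "bit3 z1"
  "bit1 z2" "\<not> bit2 z2" "bit3 z2"
  "bit1 z3" "bit2 z3" "\<not> bit3 z3"
  "bit1 w" "bit2 w" "bit3 w"
  by (simp_all add: bit1_def bit2_def bit3_def)

lemma ham_triangle: "ham u v' \<le> ham u v + ham v v'"
  unfolding ham_def by (cases "bit1 u"; cases "bit2 u"; cases "bit3 u"; cases "bit1 v"; cases "bit2 v"; cases "bit3 v") auto

lemma adj_iff_ham: "adj u v \<longleftrightarrow> ham u v = 1"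
proof -
  have "\<forall>u v. adj u v \<longleftrightarrow> ham u v = 1"
    unfolding all_vertices by (simp add: adj_iff cube_edges_def ham_def bits)
  then show ?thesis by blast
qed

lemma gdist_ham: "gdist adj u v = ham u v"
proof (rule gdist_unique)
  show "ham u u = 0" by (simp add: ham_def)
next
  fix v v' assume "adj v v'"
  then show "ham u v' \<le> Suc (ham u v)"
    using ham_triangle[of u v' v] by (simp add: adj_iff_ham)
next
  \<comment> \<open>The vertex sought is \<open>v\<close> with one bit flipped in which it differs
    from \<open>u\<close>.\<close>
  have "\<forall>u v. v \<noteq> u \<longrightarrow> (\<exists>v'. ham v' v = 1 \<and> ham u v = Suc (ham u v'))"
    unfolding all_vertices ex_vertices by (simp add: ham_def bits)
  then show "\<exists>v'. adj v' v \<and> ham u v = Suc (ham u v')" if "v \<noteq> u" for v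
    using that by (simp add: adj_iff_ham)
qed

lemma gdist_x [simp]:
  "gdist adj x x = 0" "gdist adj x y1 = 1" "gdist adj x y2 = 1" "gdist adj x y3 = 1"
  "gdist adj x z1 = 2" "gdist adj x z2 = 2" "gdist adj x z3 = 2" "gdist adj x w = 3"
  by (simp_all add: gdist_ham ham_def bits)

lemma gdiameter [simp]: "gdiameter adj = 3"
proof (rule antisym)
  obtain u v where "gdist adj u v = gdiameter adj" using gdiameter_attained by blast
  moreover have "ham u v \<le> 3" by (auto simp: ham_def)
  ultimately show "gdiameter adj \<le> 3" by (simp add: gdist_ham)
  show "3 \<le> gdiameter adj" using gdist_le_diameter[of adj x w] by simp
qed

lemma is_3cube: "is_3cube adj"
proof -
  define f :: "'v \<Rightarrow> bool^3" where
    "f u = (\<chi> i. if i = 1 then bit1 u else if i = 2 then bit2 u else bit3 u)" for u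
  have "\<forall>u v. f u = f v \<longrightarrow> u = v"
    unfolding all_vertices by (simp add: f_def vec_eq_iff forall_3 bits)
  then have "inj f" by (auto simp: inj_def)
  moreover have "CARD(bool^3) = CARD('v)" by (simp add: card_UNIV)
  ultimately have "bij f"
    by (metis bij_def card_image card_subset_eq finite top_greatest)
  moreover have "adj u v \<longleftrightarrow> cube_adj (f u) (f v)" for u v
  proof -
    have "card {i. f u $ i \<noteq> f v $ i} = (\<Sum>i\<in>UNIV. of_bool (f u $ i \<noteq> f v $ i))"
      by (simp add: of_bool_def sum.If_cases)
    also have "\<dots> = ham u v" unfolding sum_3 ham_def by (simp add: f_def)
    finally show ?thesis by (simp add: adj_iff_ham cube_adj_def)
  qed
  ultimately show ?thesis unfolding is_3cube_def by blast
qed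

end

text \<open>The intersection numbers of the cube; for fixed h, each term is a class of vertices at distances i and j from two vertices at distance h.\<close>

definition cube_number :: "nat \<Rightarrow> nat \<Rightarrow> nat \<Rightarrow> nat" where
  "cube_number h i j =
   (if h = 0 then of_bool (i = 0 \<and> j = 0) + 3 * of_bool (i = 1 \<and> j = 1) + 3 * of_bool (i = 2 \<and> j = 2) + of_bool (i = 3 \<and> j = 3)
    else if h = 1 then of_bool (i = 0 \<and> j = 1) + of_bool (i = 1 \<and> j = 0) + 2 * of_bool (i = 1 \<and> j = 2) + 2 * of_bool (i = 2 \<and> j = 1) + of_bool (i = 2 \<and> j = 3) + of_bool (i = 3 \<and> j = 2)
    else if h = 2 then of_bool (i = 0 \<and> j = 2) + 2 * of_bool (i = 1 \<and> j = 1) + of_bool (i = 1 \<and> j = 3) + of_bool (i = 2 \<and> j = 0) + 2 * of_bool (i = 2 \<and> j = 2) + of_bool (i = 3 \<and> j = 1)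
    else of_bool (i = 0 \<and> j = 3) + 3 * of_bool (i = 1 \<and> j = 2) + 3 * of_bool (i = 2 \<and> j = 1) + of_bool (i = 3 \<and> j = 0))"

text \<open>One vertex of the pair is the base point \<open>x\<close>; this is no loss, since every
  vertex of the cube can be the base point of a labelling.\<close>

lemma (in labelled_cube) card_layers:
  "card (layer adj x i \<inter> layer adj z j) = cube_number (gdist adj x z) i j"
proof -
  \<comment> \<open>Counting by indicators leaves \<open>i\<close> and \<open>j\<close> free, so all
    layer pairs are treated at once by sums of eight terms.\<close>
  have "card (layer adj x i \<inter> layer adj z j) =
      (\<Sum>u\<in>UNIV. of_bool (i = gdist adj x u \<and> j = gdist adj z u))"
    by (auto simp: of_bool_def sum.If_cases layer_def intro!: arg_cong[where f = card])
  moreover have "\<forall>z. (\<Sum>u\<in>UNIV. of_bool (i = gdist adj x u \<and> j = gdist adj z u)) =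
      cube_number (gdist adj x z) i j"
    unfolding all_vertices sum_vertices
    by (simp add: gdist_ham ham_def bits cube_number_def numeral_2_eq_2 numeral_3_eq_3)
  ultimately show ?thesis by simp
qed


section \<open>Passing between the cube, its labellings and its intersection array\<close>

lemma is_3cube_labelled:
  assumes "is_3cube adj"
  shows "\<exists>y1 y2 y3 z1 z2 z3 w. labelled_cube adj x y1 y2 y3 z1 z2 z3 w"
proof -
  obtain f where f: "bij f" "\<And>u v. adj u v \<longleftrightarrow> cube_adj (f u) (f v)"
    using assms unfolding is_3cube_def by blast
  \<comment> \<open>Adding \<open>f x\<close> modulo 2 moves \<open>x\<close> to the origin. Two
    shifted images differ in the same coordinates as before, so adjacency is still Hamming distance
    one.\<close>
  define g :: "'a \<Rightarrow> bool^3" where "g u = (\<chi> i. f u $ i \<noteq> f x $ i)" for u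
  have gi: "g u = g v \<longleftrightarrow> u = v" for u v
  proof -
    have "g u = g v \<longleftrightarrow> f u = f v" by (auto simp: g_def vec_eq_iff)
    then show ?thesis using f(1) by (auto simp: bij_def inj_eq)
  qed
  have gx: "g x = (\<chi> i. False)" by (simp add: g_def)
  have adj: "adj u v \<longleftrightarrow> card {i. g u $ i \<noteq> g v $ i} = 1" for u v
  proof -
    have "{i. g u $ i \<noteq> g v $ i} = {i. f u $ i \<noteq> f v $ i}" by (auto simp: g_def)
    then show ?thesis by (simp add: f cube_adj_def)
  qed
  have "\<exists>u. g u = c" for c
  proof -
    \<comment> \<open>The shift is its own inverse.\<close>
    obtain u where "f u = (\<chi> i. c $ i \<noteq> f x $ i)" using f(1) by (metis bij_pointE)
    then have "g u = c" by (auto simp: g_def vec_eq_iff)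
    then show ?thesis by blast
  qed
  then obtain h where h: "\<And>c. g (h c) = c" by metis
  define v where "v a b c = h (\<chi> i. if i = 1 then a else if i = 2 then b else c)" for a b c
  have gv: "g (v a b c) $ 1 = a" "g (v a b c) $ 2 = b" "g (v a b c) $ 3 = c" for a b c
    by (simp_all add: v_def h)
  have eq: "u = u' \<longleftrightarrow> g u $ 1 = g u' $ 1 \<and> g u $ 2 = g u' $ 2 \<and> g u $ 3 = g u' $ 3" for u u'
    unfolding gi[symmetric] by (simp add: vec_eq_iff forall_3)
  have gx': "\<not> g x $ i" for i by (simp add: gx)
  have count: "card {i. g u $ i \<noteq> g u' $ i} = of_bool (g u $ 1 \<noteq> g u' $ 1) +
      of_bool (g u $ 2 \<noteq> g u' $ 2) + of_bool (g u $ 3 \<noteq> g u' $ 3)" for u u'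
  proof -
    have "card {i. g u $ i \<noteq> g u' $ i} = (\<Sum>i\<in>UNIV. of_bool (g u $ i \<noteq> g u' $ i))"
      by (simp add: of_bool_def sum.If_cases)
    then show ?thesis by (simp add: sum_3)
  qed
  have "labelled_cube adj x (v True False False) (v False True False) (v False False True)
    (v False True True) (v True False True) (v True True False) (v True True True)"
  proof
    show "distinct [x, v True False False, v False True False, v False False True,
        v False True True, v True False True, v True True False, v True True True]"
      by (simp add: eq gv gx')
    show "UNIV = {x, v True False False, v False True False, v False False True,
        v False True True, v True False True, v True True False, v True True True}"
      by (rule UNIV_eq_I) (simp add: eq gv gx', blast)
  next
    fix u u'
    show "adj u u' \<longleftrightarrow> (u, u') \<in> cube_edges x (v True False False) (v False True False)
        (v False False True) (v False True True) (v True False True) (v True True False)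
        (v True True True) \<or>
      (u', u) \<in> cube_edges x (v True False False) (v False True False)
        (v False False True) (v False True True) (v True False True) (v True True False)
        (v True True True)"
      unfolding adj count cube_edges_def
      by (cases "g u $ 1"; cases "g u $ 2"; cases "g u $ 3";
          cases "g u' $ 1"; cases "g u' $ 2"; cases "g u' $ 3") (simp_all add: eq gv gx')
  qed
  then show ?thesis by blast
qed

lemma is_3cube_distance_regular:
  assumes "is_3cube adj"
  shows "distance_regular adj \<and> CARD('v::finite) = 8 \<and>
    intersection_array (adj :: 'v \<Rightarrow> 'v \<Rightarrow> bool) = ([3, 2, 1], [1, 2, 3])"
proof -
  have card: "card (layer adj y i \<inter> layer adj z j) = cube_number (gdist adj y z) i j" for y z i j
    using is_3cube_labelled[OF assms, of y] labelled_cube.card_layers by fast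
  then have dr: "distance_regular adj"
    unfolding distance_regular_def by metis
  obtain x y1 y2 y3 z1 z2 z3 w where "labelled_cube adj x y1 y2 y3 z1 z2 z3 w"
    using is_3cube_labelled[OF assms] by blast
  then interpret labelled_cube adj x y1 y2 y3 z1 z2 z3 w .
  have "intersection_number adj h i j = cube_number h i j" if "h \<le> 3" "i \<le> 3" "j \<le> 3" for h i j
  proof -
    \<comment> \<open>A witness at each distance up to 3, so that the definite description has a
      unique value.\<close>
    have "\<exists>z. gdist adj x z = h"
      using that(1) unfolding ex_vertices by (auto simp: le_Suc_eq numeral_3_eq_3)
    then show ?thesis
      using intersection_number_card[OF dr, of h i j x] card that by auto
  qed
  then have "intersection_array adj = ([3, 2, 1], [1, 2, 3])"
    by (simp add: intersection_array_def cube_number_def upt_rec)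
  then show ?thesis using dr card_UNIV by blast
qed

text \<open>Any two neighbours of \<open>x\<close> have exactly one further common neighbour; this
  produces the three \<open>z\<close>. Counting vertices leaves a single \<open>w\<close>, and the
  degree leaves no other end for the third edge at each \<open>z\<close>.\<close>

lemma cubical_labelled:
  fixes adj :: "'v::finite \<Rightarrow> 'v \<Rightarrow> bool"
  assumes simple: "connected_simple_graph adj"
    and degree: "\<And>u. card {v. adj u v} = 3"
    and triangle_free: "\<And>u v t. adj u v \<Longrightarrow> adj v t \<Longrightarrow> \<not> adj u t"
    and common: "\<And>u v t. adj u v \<Longrightarrow> adj v t \<Longrightarrow> u \<noteq> t \<Longrightarrow> card {s. adj u s \<and> adj t s} = 2"
    and card: "CARD('v) = 8"
    and nbrs: "{v. adj x v} = {y1, y2, y3}" and dist: "distinct [y1, y2, y3]"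
  shows "\<exists>z1 z2 z3 w. labelled_cube adj x y1 y2 y3 z1 z2 z3 w"
proof -
  have sym: "adj u v \<longleftrightarrow> adj v u" and irr: "\<not> adj u u" for u v
    using simple by (auto simp: connected_simple_graph_def symp_def irreflp_def)
  have xy: "adj x y1" "adj x y2" "adj x y3" "\<And>v. adj x v \<longleftrightarrow> v = y1 \<or> v = y2 \<or> v = y3"
    using nbrs by blast+
  have ex: "\<exists>z. z \<noteq> x \<and> adj u z \<and> adj v z \<and> (\<forall>s. adj u s \<and> adj v s \<longrightarrow> s = x \<or> s = z)"
    if "adj x u" "adj x v" "u \<noteq> v" for u v
  proof -
    have "card {s. adj u s \<and> adj v s} = 2"
      using common[of u x v] that sym by auto
    then obtain p q where pq: "{s. adj u s \<and> adj v s} = {p, q}" "p \<noteq> q"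
      by (auto simp: card_2_iff)
    then have "adj u s \<and> adj v s \<longleftrightarrow> s = p \<or> s = q" for s by blast
    moreover have "adj u x" "adj v x" using that sym by auto
    ultimately show ?thesis using pq(2) by metis
  qed
  have ne: "y1 \<noteq> y2" "y1 \<noteq> y3" "y2 \<noteq> y3" using dist by auto
  obtain z1 where z1: "z1 \<noteq> x" "adj y2 z1" "adj y3 z1" "\<And>s. adj y2 s \<Longrightarrow> adj y3 s \<Longrightarrow> s = x \<or> s = z1"
    using ex[OF xy(2) xy(3) ne(3)] by blast
  obtain z2 where z2: "z2 \<noteq> x" "adj y1 z2" "adj y3 z2" "\<And>s. adj y1 s \<Longrightarrow> adj y3 s \<Longrightarrow> s = x \<or> s = z2"
    using ex[OF xy(1) xy(3) ne(2)] by blast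
  obtain z3 where z3: "z3 \<noteq> x" "adj y1 z3" "adj y2 z3" "\<And>s. adj y1 s \<Longrightarrow> adj y2 s \<Longrightarrow> s = x \<or> s = z3"
    using ex[OF xy(1) xy(2) ne(1)] by blast
  \<comment> \<open>Such an \<open>s\<close> would have three common neighbours with
    \<open>x\<close>, while distinct vertices joined by a walk of length two have only two. This is
    what keeps the three \<open>z\<close> apart.\<close>
  have no3: "\<not> (adj y1 s \<and> adj y2 s \<and> adj y3 s)" if "s \<noteq> x" for s
  proof
    assume s: "adj y1 s \<and> adj y2 s \<and> adj y3 s"
    have "card {t. adj x t \<and> adj s t} = 2"
      using common[of x y1 s] that xy s by auto
    moreover have "{t. adj x t \<and> adj s t} = {y1, y2, y3}"
      using xy s sym by auto
    ultimately show False using dist by simp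
  qed
  have zz: "z1 \<noteq> z2" "z1 \<noteq> z3" "z2 \<noteq> z3"
    using no3 z1 z2 z3 by blast+
  have xz: "\<not> adj x z1" "\<not> adj x z2" "\<not> adj x z3"
    using triangle_free xy z1 z2 z3 by blast+
  have xny: "x \<noteq> y1" "x \<noteq> y2" "x \<noteq> y3" using xy irr by auto
  have yz: "y1 \<noteq> z1" "y1 \<noteq> z2" "y1 \<noteq> z3" "y2 \<noteq> z1" "y2 \<noteq> z2" "y2 \<noteq> z3"
    "y3 \<noteq> z1" "y3 \<noteq> z2" "y3 \<noteq> z3"
    using xy(1-3) xz by metis+
  have d7: "distinct [x, y1, y2, y3, z1, z2, z3]"
    using dist zz xny yz z1(1) z2(1) z3(1) by simp
  have "card (UNIV - {x, y1, y2, y3, z1, z2, z3}) = 1"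
    using d7 card by (subst card_Diff_subset) auto
  then obtain w where w: "UNIV - {x, y1, y2, y3, z1, z2, z3} = {w}"
    by (auto simp: card_1_singleton_iff)
  then have d8: "distinct [x, y1, y2, y3, z1, z2, z3, w]" using d7 by auto
  have U: "UNIV = {x, y1, y2, y3, z1, z2, z3, w}" using w by blast
  have in_U: "v = x \<or> v = y1 \<or> v = y2 \<or> v = y3 \<or> v = z1 \<or> v = z2 \<or> v = z3 \<or> v = w" for v
    using U by blast
  \<comment> \<open>Three known neighbours exhaust the degree.\<close>
  have full: "adj u v \<longleftrightarrow> v \<in> {a, b, c}"
    if "adj u a" "adj u b" "adj u c" "distinct [a, b, c]" for u v a b c
  proof -
    have "{a, b, c} = {v. adj u v}"
      using that degree[of u] by (intro card_subset_eq) auto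
    then show ?thesis by blast
  qed
  have yx: "adj y1 x" "adj y2 x" "adj y3 x" using xy(1-3) sym by blast+
  have y1: "adj y1 v \<longleftrightarrow> v \<in> {x, z2, z3}" for v
    using yx z2(2) z3(2) d7 by (intro full) auto
  have y2: "adj y2 v \<longleftrightarrow> v \<in> {x, z1, z3}" for v
    using yx z1(2) z3(3) d7 by (intro full) auto
  have y3: "adj y3 v \<longleftrightarrow> v \<in> {x, z1, z2}" for v
    using yx z1(3) z2(3) d7 by (intro full) auto
  have zy: "adj z1 y2" "adj z1 y3" "adj z2 y1" "adj z2 y3" "adj z3 y1" "adj z3 y2"
    using z1(2,3) z2(2,3) z3(2,3) sym by blast+
  have nzz: "\<not> adj z1 z2" "\<not> adj z1 z3" "\<not> adj z2 z3"
    using triangle_free zy y1 y2 y3 by blast+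
  \<comment> \<open>The edge to \<open>w\<close> is found by exclusion: a vertex with only two
    neighbours other than \<open>w\<close> still lacks one.\<close>
  have third: "adj u w" if "card {v. adj u v \<and> v \<noteq> w} = 2" for u
  proof (rule ccontr)
    assume "\<not> adj u w"
    then have "{v. adj u v \<and> v \<noteq> w} = {v. adj u v}" by auto
    then show False using that degree[of u] by simp
  qed
  have zx: "\<not> adj z1 x" "\<not> adj z2 x" "\<not> adj z3 x" using xz sym by blast+
  have nzy: "\<not> adj z1 y1" "\<not> adj z2 y2" "\<not> adj z3 y3"
    using sym[of _ y1] sym[of _ y2] sym[of _ y3] y1 y2 y3 d8 by auto
  have nzz': "\<not> adj z2 z1" "\<not> adj z3 z1" "\<not> adj z3 z2" using nzz sym by blast+
  have zw: "adj z1 w" "adj z2 w" "adj z3 w"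
  proof -
    have "v \<in> {v. adj z1 v \<and> v \<noteq> w} \<longleftrightarrow> v \<in> {y2, y3}" for v
      using in_U[of v] by (elim disjE; hypsubst) (use nzz nzz' irr zx nzy zy d8 in auto)
    then have "{v. adj z1 v \<and> v \<noteq> w} = {y2, y3}" by blast
    then show "adj z1 w" using d8 by (intro third) simp
    have "v \<in> {v. adj z2 v \<and> v \<noteq> w} \<longleftrightarrow> v \<in> {y1, y3}" for v
      using in_U[of v] by (elim disjE; hypsubst) (use nzz nzz' irr zx nzy zy d8 in auto)
    then have "{v. adj z2 v \<and> v \<noteq> w} = {y1, y3}" by blast
    then show "adj z2 w" using d8 by (intro third) simp
    have "v \<in> {v. adj z3 v \<and> v \<noteq> w} \<longleftrightarrow> v \<in> {y1, y2}" for v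
      using in_U[of v] by (elim disjE; hypsubst) (use nzz nzz' irr zx nzy zy d8 in auto)
    then have "{v. adj z3 v \<and> v \<noteq> w} = {y1, y2}" by blast
    then show "adj z3 w" using d8 by (intro third) simp
  qed
  have z1': "adj z1 v \<longleftrightarrow> v \<in> {y2, y3, w}" for v
    using zy zw d8 by (intro full) auto
  have z2': "adj z2 v \<longleftrightarrow> v \<in> {y1, y3, w}" for v
    using zy zw d8 by (intro full) auto
  have z3': "adj z3 v \<longleftrightarrow> v \<in> {y1, y2, w}" for v
    using zy zw d8 by (intro full) auto
  have w': "adj w v \<longleftrightarrow> v \<in> {z1, z2, z3}" for v
    using zw sym d8 by (intro full) auto
  have "labelled_cube adj x y1 y2 y3 z1 z2 z3 w"
  proof
    fix u v
    show "adj u v \<longleftrightarrow> (u, v) \<in> cube_edges x y1 y2 y3 z1 z2 z3 w \<or> (v, u) \<in> cube_edges x y1 y2 y3 z1 z2 z3 w"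
      using in_U[of u]
      by (elim disjE; hypsubst) (use d8 in \<open>auto simp: cube_edges_def xy(4) y1 y2 y3 z1' z2' z3' w'\<close>)
  qed (use d8 U in auto)
  then show ?thesis by blast
qed

text \<open>The numbers used are \<open>b0\<close> = 3, \<open>b1\<close> = 2 and \<open>c2\<close>
  = 2. Of the three neighbours of \<open>v\<close>, one is a given neighbour \<open>u\<close> and
  the other two lie at distance two from \<open>u\<close>, which rules out triangles;
  \<open>c2\<close> counts common neighbours at distance two. The vertex names follow the order of
  \<open>ys\<close>.\<close>

lemma distance_regular_labelled:
  fixes adj :: "'v::finite \<Rightarrow> 'v \<Rightarrow> bool"
  assumes simple: "connected_simple_graph adj" and dr: "distance_regular adj"
    and card: "CARD('v) = 8" and arr: "intersection_array adj = ([3, 2, 1], [1, 2, 3])"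
    and ys: "distinct ys" "set ys = layer adj x 1"
  shows "\<exists>y1 y2 y3 z1 z2 z3 w. ys = [y1, y2, y3] \<and> labelled_cube adj x y1 y2 y3 z1 z2 z3 w"
proof -
  have "length (fst (intersection_array adj)) = 3" by (simp add: arr)
  then have D: "gdiameter adj = 3" by (simp add: intersection_array_def)
  have num: "intersection_number adj 0 1 1 = 3" "intersection_number adj 1 1 2 = 2"
    "intersection_number adj 2 1 1 = 2"
    using arr unfolding intersection_array_def D by (simp_all add: upt_rec numeral_2_eq_2)
  have layer1: "layer adj u 1 = {v. adj u v}" for u
    using gdist_eq_1_iff[OF simple] by (simp add: layer_def)
  have sym: "adj u v \<longleftrightarrow> adj v u" for u v
    using simple by (auto simp: connected_simple_graph_def symp_def)
  have degree: "card {v. adj u v} = 3" for u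
    using intersection_number_card[OF dr, of 0 1 1 u u] D num(1) layer1[of u]
    by (simp add: gdist_self)
  have triangle_free: "\<not> adj u t" if "adj u v" "adj v t" for u v t
  proof
    assume ut: "adj u t"
    have "card (layer adj v 1 \<inter> layer adj u 2) = 2"
      using intersection_number_card[OF dr, of 1 1 2 v u] D num(2) that sym
        gdist_eq_1_iff[OF simple, of v u] by simp
    moreover have "layer adj v 1 \<inter> layer adj u 2 \<subseteq> {s. adj v s} - {u, t}"
      using gdist_eq_1_iff[OF simple, of u t] ut layer1[of v] by (auto simp: layer_def gdist_self)
    then have "card (layer adj v 1 \<inter> layer adj u 2) \<le> card ({s. adj v s} - {u, t})"
      by (intro card_mono) auto
    moreover have "u \<noteq> t" using ut simple by (auto simp: connected_simple_graph_def irreflp_def)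
    then have "card ({s. adj v s} - {u, t}) = 1"
      using degree[of v] that sym[of u v] by (subst card_Diff_subset) auto
    ultimately show False by simp
  qed
  have common: "card {s. adj u s \<and> adj t s} = 2" if "adj u v" "adj v t" "u \<noteq> t" for u v t
  proof -
    have "gdist adj u t = 2"
      using that triangle_free by (intro gdist_eq_2I[OF simple]) auto
    then have "card (layer adj u 1 \<inter> layer adj t 1) = 2"
      using intersection_number_card[OF dr, of 2 1 1 u t] D num(3) by simp
    then show ?thesis unfolding layer1 Collect_conj_eq .
  qed
  have nbrs: "set ys = {v. adj x v}" using ys(2) layer1 by simp
  then have "length ys = 3" using degree[of x] distinct_card[OF ys(1)] by simp
  then obtain y1 y2 y3 where y: "ys = [y1, y2, y3]"
    by (auto simp: numeral_3_eq_3 length_Suc_conv)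
  then have "\<exists>z1 z2 z3 w. labelled_cube adj x y1 y2 y3 z1 z2 z3 w"
    using ys(1) nbrs by (intro cubical_labelled[OF simple degree triangle_free common card]) auto
  then show ?thesis using y by blast
qed

lemma is_3cube_iff:
  fixes adj :: "'v::finite \<Rightarrow> 'v \<Rightarrow> bool"
  assumes "connected_simple_graph adj"
  shows "is_3cube adj \<longleftrightarrow>
    distance_regular adj \<and> CARD('v) = 8 \<and> intersection_array adj = ([3, 2, 1], [1, 2, 3])"
proof
  assume "distance_regular adj \<and> CARD('v) = 8 \<and> intersection_array adj = ([3, 2, 1], [1, 2, 3])"
  \<comment> \<open>Any base vertex and any order of its neighbours serve here.\<close>
  moreover obtain ys where "distinct ys" "set ys = layer adj undefined 1"
    using finite_distinct_list[of "layer adj undefined 1"] by auto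
  ultimately show "is_3cube adj"
    using distance_regular_labelled[OF assms, of ys undefined] labelled_cube.is_3cube by metis
qed (rule is_3cube_distance_regular)

subsection \<open>Linear algebra\<close>

lemma matrix_vector_smult: "M *v (c *s v) = c *s (M *v v)" for M :: "complex^'n^'m"
  by (simp add: vec_eq_iff matrix_vector_mult_def sum_distrib_left algebra_simps)

lemma smult_matrix_vector: "smult_matrix c M *v v = c *s (M *v v)" for M :: "complex^'n^'m"
  by (simp add: vec_eq_iff matrix_vector_mult_def smult_matrix_def sum_distrib_left algebra_simps)

lemma smult_matrix_nth [simp]: "smult_matrix c M $ i $ j = c * M $ i $ j"
  by (simp add: smult_matrix_def)

lemma dual_idempotent_nth: "(dual_idempotent adj x i *v v) $ y = (if gdist adj x y = i then v $ y else 0)"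
  by (simp add: matrix_vector_mult_def dual_idempotent_def if_distrib[of "\<lambda>c. c * _"] sum.If_cases
      cong: if_cong)

text \<open>A coordinate at which only one vector is nonzero isolates the coefficient of that vector
  in a vanishing combination.\<close>

lemma independent_pivots:
  fixes B :: "(complex^'n) set"
  assumes "finite B" and piv: "\<And>b. b \<in> B \<Longrightarrow> \<exists>y. b $ y \<noteq> 0 \<and> (\<forall>b'\<in>B - {b}. b' $ y = 0)"
  shows "vec.independent B"
proof -
  have "u b = 0" if u: "(\<Sum>b\<in>B. u b *s b) = 0" and b: "b \<in> B" for u b
  proof -
    obtain y where y: "b $ y \<noteq> 0" "\<forall>b'\<in>B - {b}. b' $ y = 0" using piv[OF b] by blast
    have "0 = (\<Sum>b\<in>B. u b *s b) $ y" by (simp add: u)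
    also have "\<dots> = (\<Sum>b\<in>B. u b * b $ y)" by simp
    also have "\<dots> = u b * b $ y + (\<Sum>b'\<in>B - {b}. u b' * b' $ y)"
      by (rule sum.remove[OF \<open>finite B\<close> b])
    also have "(\<Sum>b'\<in>B - {b}. u b' * b' $ y) = 0" using y(2) by (intro sum.neutral) auto
    finally show ?thesis using y(1) by simp
  qed
  then show ?thesis using vec.dependent_finite[OF \<open>finite B\<close>] by blast
qed

lemma herm_inner_add_left: "herm_inner (u + v) t = herm_inner u t + herm_inner v t"
  by (simp add: herm_inner_def sum.distrib algebra_simps)
lemma herm_inner_add_right: "herm_inner t (u + v) = herm_inner t u + herm_inner t v"
  by (simp add: herm_inner_def sum.distrib algebra_simps)
lemma herm_inner_smult_left: "herm_inner (c *s u) t = c * herm_inner u t"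
  by (simp add: herm_inner_def sum_distrib_left algebra_simps)
lemma herm_inner_smult_right: "herm_inner t (c *s u) = cnj c * herm_inner t u"
  by (simp add: herm_inner_def sum_distrib_left algebra_simps)

lemma herm_inner_sum_left: "herm_inner (\<Sum>i\<in>I. f i) t = (\<Sum>i\<in>I. herm_inner (f i) t)"
proof (cases "finite I")
  case True
  then show ?thesis
    by induction (simp_all add: herm_inner_add_left, simp add: herm_inner_def)
qed (simp add: herm_inner_def)

lemma herm_inner_self_eq_0_iff: "herm_inner v v = 0 \<longleftrightarrow> v = 0"
proof
  assume "herm_inner v v = 0"
  moreover have "herm_inner v v = of_real (\<Sum>y\<in>UNIV. (cmod (v $ y))\<^sup>2)"
    by (simp add: herm_inner_def complex_norm_square[symmetric] del: of_real_power)
  ultimately have "(\<Sum>y\<in>UNIV. (cmod (v $ y))\<^sup>2) = 0" by (metis of_real_eq_0_iff)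
  then show "v = 0" by (simp add: sum_nonneg_eq_0_iff vec_eq_iff)
qed (simp add: herm_inner_def)

lemma independent_orthogonal:
  fixes B :: "(complex^'n) set"
  assumes "finite B" "0 \<notin> B" and orth: "\<And>u v. u \<in> B \<Longrightarrow> v \<in> B \<Longrightarrow> u \<noteq> v \<Longrightarrow> herm_inner u v = 0"
  shows "vec.independent B"
proof -
  have "c b = 0" if c: "(\<Sum>b\<in>B. c b *s b) = 0" and b: "b \<in> B" for c b
  proof -
    have "0 = herm_inner (\<Sum>b\<in>B. c b *s b) b" by (simp add: c) (simp add: herm_inner_def)
    also have "\<dots> = (\<Sum>b'\<in>B. c b' * herm_inner b' b)"
      by (simp add: herm_inner_sum_left herm_inner_smult_left)
    also have "\<dots> = c b * herm_inner b b + (\<Sum>b'\<in>B - {b}. c b' * herm_inner b' b)"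
      by (rule sum.remove[OF \<open>finite B\<close> b])
    also have "(\<Sum>b'\<in>B - {b}. c b' * herm_inner b' b) = 0"
      using orth b by (intro sum.neutral) auto
    finally show ?thesis using b \<open>0 \<notin> B\<close> by (auto simp: herm_inner_self_eq_0_iff)
  qed
  then show ?thesis using vec.dependent_finite[OF \<open>finite B\<close>] by blast
qed

subsection \<open>The Terwilliger algebra\<close>

text \<open>The matrices with property \<open>P\<close> form a subalgebra containing the generators,
  hence they contain the hull. The zero matrix is no separate case, being \<open>0\<close> times
  \<open>mat 1\<close>.\<close>

lemma terwilliger_algebra_induct [consumes 1, case_names adjacency dual one add smult mult]:
  fixes P :: "complex^'v::finite^'v \<Rightarrow> bool"
  assumes "M \<in> terwilliger_algebra adj x"
    and "P (adjacency_matrix adj)" "\<And>i. i \<le> gdiameter adj \<Longrightarrow> P (dual_idempotent adj x i)"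
    and "P (mat 1)" "\<And>M N. P M \<Longrightarrow> P N \<Longrightarrow> P (M + N)" "\<And>c M. P M \<Longrightarrow> P (smult_matrix c M)"
    and "\<And>M N. P M \<Longrightarrow> P N \<Longrightarrow> P (M ** N)"
  shows "P M"
proof -
  have "P 0" using assms(6)[OF assms(4), of 0] by (metis cmat.scale_zero_left)
  then have "matrix_subalgebra (Collect P)"
    using assms(4-7) by (auto simp: matrix_subalgebra_def cmat.subspace_def)
  then have "terwilliger_algebra adj x \<subseteq> Collect P"
    unfolding terwilliger_algebra_def using assms(2,3) by (intro hull_minimal) auto
  then show ?thesis using assms(1) by blast
qed

lemma terwilliger_algebra_adjacency: "adjacency_matrix adj \<in> terwilliger_algebra adj x"
  and terwilliger_algebra_dual:
    "i \<le> gdiameter adj \<Longrightarrow> dual_idempotent adj x i \<in> terwilliger_algebra adj x"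
  unfolding terwilliger_algebra_def by (auto intro!: hull_inc)

lemma matrix_subalgebra_terwilliger: "matrix_subalgebra (terwilliger_algebra adj x)"
  unfolding terwilliger_algebra_def
proof (rule hull_in)
  show "matrix_subalgebra (\<Inter> F)" if "\<forall>S\<in>F. matrix_subalgebra S" for F :: "(complex^'a^'a) set set"
    using that by (auto simp: matrix_subalgebra_def cmat.subspace_def)
qed

text \<open>The matrices that preserve a given subspace are closed under all operations of the
  algebra, so invariance need only be tested on the generators.\<close>

lemma T_module_iff:
  "T_module adj x W \<longleftrightarrow> vec.subspace W \<and> (\<forall>w\<in>W. adjacency_matrix adj *v w \<in> W) \<and>
    (\<forall>i\<le>gdiameter adj. \<forall>w\<in>W. dual_idempotent adj x i *v w \<in> W)"
proof
  assume R: "vec.subspace W \<and> (\<forall>w\<in>W. adjacency_matrix adj *v w \<in> W) \<and>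
    (\<forall>i\<le>gdiameter adj. \<forall>w\<in>W. dual_idempotent adj x i *v w \<in> W)"
  have "\<forall>w\<in>W. B *v w \<in> W" if "B \<in> terwilliger_algebra adj x" for B
    using that
    by (induction rule: terwilliger_algebra_induct)
      (use R in \<open>auto simp: matrix_vector_mult_add_rdistrib smult_matrix_vector
        matrix_vector_mul_assoc[symmetric] intro: vec.subspace_add vec.subspace_scale\<close>)
  then show "T_module adj x W" using R by (simp add: T_module_def)
qed (auto simp: T_module_def terwilliger_algebra_adjacency terwilliger_algebra_dual)

lemma T_isomorphicI:
  assumes W: "T_module adj x U"
    and bij: "bij_betw f U W"
    and lin: "\<And>u v. u \<in> U \<Longrightarrow> v \<in> U \<Longrightarrow> f (u + v) = f u + f v" "\<And>c u. u \<in> U \<Longrightarrow> f (c *s u) = c *s f u"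
    and adjacency: "\<And>u. u \<in> U \<Longrightarrow> f (adjacency_matrix adj *v u) = adjacency_matrix adj *v f u"
    and dual: "\<And>i u. i \<le> gdiameter adj \<Longrightarrow> u \<in> U \<Longrightarrow>
      f (dual_idempotent adj x i *v u) = dual_idempotent adj x i *v f u"
  shows "T_isomorphic adj x U W"
proof -
  have "vec.subspace U" using W by (simp add: T_module_def)
  \<comment> \<open>Invariance of \<open>U\<close> is carried along in the induction:
    \<open>f\<close> is controlled only on \<open>U\<close>, so the product case needs
    \<open>B *v u\<close> to stay there.\<close>
  have "\<forall>u\<in>U. B *v u \<in> U \<and> f (B *v u) = B *v f u" if "B \<in> terwilliger_algebra adj x" for B
    using that
    by (induction rule: terwilliger_algebra_induct)
      (use W \<open>vec.subspace U\<close> in \<open>auto simp: T_module_iff matrix_vector_mult_add_rdistrib smult_matrix_vector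
        matrix_vector_mul_assoc[symmetric] lin adjacency dual intro: vec.subspace_add vec.subspace_scale\<close>)
  then show ?thesis unfolding T_isomorphic_def using bij lin by blast
qed

text \<open>Isomorphisms commute with the dual idempotents, so they preserve the support of a
  module; this is the invariant that separates the two types.\<close>

lemma T_isomorphic_module_layer:
  assumes iso: "T_isomorphic adj x U W" and "T_module adj x U" "i \<le> gdiameter adj"
  shows "module_layer adj x U i \<noteq> {0} \<longleftrightarrow> module_layer adj x W i \<noteq> {0}"
proof -
  obtain f where f: "bij_betw f U W" "\<forall>B\<in>terwilliger_algebra adj x. \<forall>u\<in>U. f (B *v u) = B *v f u"
    "\<forall>c. \<forall>u\<in>U. f (c *s u) = c *s f u"
    using iso unfolding T_isomorphic_def by blast
  let ?E = "dual_idempotent adj x i"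
  have E: "?E \<in> terwilliger_algebra adj x" using assms by (intro terwilliger_algebra_dual)
  have 0: "0 \<in> U" using assms(2) vec.subspace_0 by (auto simp: T_module_def)
  then have f0: "f 0 = 0" using f(3)[rule_format, of 0 0] by simp
  have f0_iff: "f u = 0 \<longleftrightarrow> u = 0" if "u \<in> U" for u
    using f0 f(1) that 0 by (auto simp: bij_betw_def inj_on_def)
  have "W = f ` U" using f(1) by (simp add: bij_betw_def)
  then have *: "module_layer adj x W i = f ` module_layer adj x U i"
    using f(2) E by (auto simp: module_layer_def image_image)
  have "module_layer adj x U i \<subseteq> U"
    using assms by (auto simp: module_layer_def T_module_iff)
  then have "v \<in> module_layer adj x U i \<Longrightarrow> f v = 0 \<longleftrightarrow> v = 0" for v using f0_iff by blast
  moreover have "0 \<in> module_layer adj x U i"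
    using 0 by (force simp: module_layer_def)
  ultimately show ?thesis unfolding * using f0 by (auto simp: image_iff)
qed

declare One_nat_def [simp del]

lemma nat_le_3_iff: "i \<le> 3 \<longleftrightarrow> i = 0 \<or> i = 1 \<or> i = 2 \<or> i = 3" for i :: nat
  by auto

subsection \<open>Modules of the cube\<close>

lemma T_module_span:
  assumes "\<And>b. b \<in> B \<Longrightarrow> adjacency_matrix adj *v b \<in> vec.span B"
    and "\<And>b i. b \<in> B \<Longrightarrow> i \<le> gdiameter adj \<Longrightarrow> dual_idempotent adj x i *v b \<in> vec.span B"
  shows "T_module adj x (vec.span B)"
proof -
  have "M *v v \<in> vec.span B" if M: "\<forall>b\<in>B. M *v b \<in> vec.span B" and v: "v \<in> vec.span B"
    for M :: "complex^'a^'a" and v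
    using v
    by (induction rule: vec.span_induct_alt)
      (use M in \<open>auto simp: matrix_vector_right_distrib matrix_vector_smult vec.span_zero
        intro!: vec.span_add vec.span_scale\<close>)
  then show ?thesis using assms unfolding T_module_iff by (auto simp: vec.subspace_span)
qed

lemma subspace_scaleD:
  assumes "vec.subspace U" "c *s v \<in> U" "c \<noteq> 0"
  shows "v \<in> U"
proof -
  have "v = inverse c *s (c *s v)" using assms(3) by (simp add: vec_eq_iff)
  then show ?thesis using vec.subspace_scale[OF assms(1,2), of "inverse c"] by metis
qed

lemma span_single_eq_0: "v \<noteq> 0 \<Longrightarrow> vec.span {v} \<noteq> {0}" for v :: "complex^'n"
  using vec.span_base[of v "{v}"] by auto

lemma module_layer_span: "module_layer adj x (vec.span B) i = vec.span ((*v) (dual_idempotent adj x i) ` B)"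
  unfolding module_layer_def by (rule vec.span_image[symmetric])

lemma herm_inner_commute: "herm_inner u v = cnj (herm_inner v u)"
  by (simp add: herm_inner_def mult.commute)

lemma herm_inner_span:
  assumes "\<And>a b. a \<in> P \<Longrightarrow> b \<in> Q \<Longrightarrow> herm_inner a b = 0"
    and "u \<in> vec.span P" "v \<in> vec.span Q"
  shows "herm_inner u v = 0"
proof -
  have 1: "herm_inner a v = 0" if "a \<in> P" for a
    using assms(3)
    by (induction rule: vec.span_induct_alt)
      (use that assms(1) in \<open>auto simp: herm_inner_add_right herm_inner_smult_right, simp add: herm_inner_def\<close>)
  show ?thesis
    using assms(2)
    by (induction rule: vec.span_induct_alt)
      (use 1 in \<open>auto simp: herm_inner_add_left herm_inner_smult_left, simp add: herm_inner_def\<close>)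
qed

lemma span_pair: "vec.span {a, b} = {s *s a + t *s b | s t. True}"
  by (auto simp: vec.span_insert vec.span_singleton algebra_simps)

section \<open>The two kinds of irreducible modules, in coordinates\<close>

context labelled_cube
begin

abbreviation "A \<equiv> adjacency_matrix adj"
abbreviation "E \<equiv> dual_idempotent adj x"
abbreviation "e \<equiv> layer_vector adj x"

lemma vec_eq: "u = v \<longleftrightarrow> u $ x = v $ x \<and> u $ y1 = v $ y1 \<and> u $ y2 = v $ y2 \<and> u $ y3 = v $ y3 \<and>
    u $ z1 = v $ z1 \<and> u $ z2 = v $ z2 \<and> u $ z3 = v $ z3 \<and> u $ w = v $ w"
  unfolding vec_eq_iff all_vertices ..

lemma A_nth [simp]:
  "(A *v v) $ x = v $ y1 + v $ y2 + v $ y3"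
  "(A *v v) $ y1 = v $ x + v $ z2 + v $ z3"
  "(A *v v) $ y2 = v $ x + v $ z1 + v $ z3"
  "(A *v v) $ y3 = v $ x + v $ z1 + v $ z2"
  "(A *v v) $ z1 = v $ y2 + v $ y3 + v $ w"
  "(A *v v) $ z2 = v $ y1 + v $ y3 + v $ w"
  "(A *v v) $ z3 = v $ y1 + v $ y2 + v $ w"
  "(A *v v) $ w = v $ z1 + v $ z2 + v $ z3"
  by (simp_all add: matrix_vector_mult_def adjacency_matrix_def sum_vertices adj_iff cube_edges_def)

lemma E_nth [simp]: "(E i *v v) $ y = (if gdist adj x y = i then v $ y else 0)"
  by (rule dual_idempotent_nth)

lemma e_nth [simp]: "e i $ y = (if gdist adj x y = i then 1 else 0)"
  by (simp add: layer_vector_def)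

text \<open>The coefficient of \<open>e j\<close> in \<open>A *v e i\<close> counts the neighbours
  in layer \<open>i\<close> of a vertex in layer \<open>j\<close>; these are the \<open>b\<close>
  and \<open>c\<close> of the intersection array.\<close>

lemma A_e:
  "A *v e 0 = e 1" "A *v e 1 = 3 *s e 0 + 2 *s e 2" "A *v e 2 = 2 *s e 1 + 3 *s e 3" "A *v e 3 = e 2"
  by (simp_all add: vec_eq)

lemma E_e: "E i *v e j = (if i = j then e j else 0)"
  by (auto simp: vec_eq_iff)

text \<open>This is the primary module, the one generated by \<open>e 0\<close>.\<close>

definition "W0 = vec.span {e 0, e 1, e 2, e 3}"
definition "W1 \<nu> = vec.span {\<nu>, A *v \<nu>}"

lemma e_neqs: "distinct [e 0, e 1, e 2, e 3]" and e_nonzero: "i \<le> 3 \<Longrightarrow> e i \<noteq> 0"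
  by (auto simp: vec_eq nat_le_3_iff)

lemma independent_e: "vec.independent {e 0, e 1, e 2, e 3}"
proof (rule independent_pivots)
  have *: "\<exists>y. e i $ y \<noteq> 0 \<and> (\<forall>b'\<in>{e 0, e 1, e 2, e 3} - {e i}. b' $ y = 0)" if "i \<le> 3" for i
  proof -
    have "\<exists>y. gdist adj x y = i" using that gdist_x unfolding nat_le_3_iff by metis
    then obtain y where "gdist adj x y = i" by blast
    then have "e i $ y \<noteq> 0 \<and> (\<forall>b'\<in>{e 0, e 1, e 2, e 3} - {e i}. b' $ y = 0)"
      by (auto split: if_splits)
    then show ?thesis by blast
  qed
  show "\<exists>y. b $ y \<noteq> 0 \<and> (\<forall>b'\<in>{e 0, e 1, e 2, e 3} - {b}. b' $ y = 0)"
    if "b \<in> {e 0, e 1, e 2, e 3}" for b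
  proof -
    have "b \<in> e ` {0, 1, 2, 3}" using that by simp
    then obtain i where i: "b = e i" "i \<in> {0, 1, 2, 3}" by (rule imageE)
    then have "i \<le> 3" by (auto simp del: e_nth)
    then show ?thesis unfolding i(1) by (rule *)
  qed
qed simp

lemma T_module_W0: "T_module adj x W0"
  unfolding W0_def
proof (rule T_module_span)
  fix b assume "b \<in> {e 0, e 1, e 2, e 3}"
  then show "A *v b \<in> vec.span {e 0, e 1, e 2, e 3}"
    by (auto simp: A_e intro!: vec.span_add vec.span_scale intro: vec.span_base)
  fix i
  show "E i *v b \<in> vec.span {e 0, e 1, e 2, e 3}"
    using \<open>b \<in> _\<close> by (auto simp: E_e vec.span_zero intro: vec.span_base)
qed

text \<open>On \<open>W0\<close> this makes each projection \<open>E i *v u\<close> a multiple of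
  \<open>e i\<close>, the starting point for irreducibility.\<close>

lemma W0_nth_eq:
  assumes "u \<in> W0" "gdist adj x y = gdist adj x y'"
  shows "u $ y = u $ y'"
  using assms(1) unfolding W0_def
  by (induction rule: vec.span_induct_alt) (use assms(2) in auto)

text \<open>From \<open>e i\<close> the matrix \<open>A\<close> reaches each adjacent layer with a
  nonzero coefficient, and the projections \<open>E\<close> split the result; hence any one of the
  four vectors generates the others.\<close>

lemma W0_subset:
  assumes U: "T_module adj x U" and i: "i \<le> 3" "e i \<in> U"
  shows "W0 \<subseteq> U"
proof -
  have sub: "vec.subspace U" and A: "\<And>u. u \<in> U \<Longrightarrow> A *v u \<in> U"
    and E: "\<And>u i. i \<le> 3 \<Longrightarrow> u \<in> U \<Longrightarrow> E i *v u \<in> U"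
    using U by (auto simp: T_module_iff)
  note scale = subspace_scaleD[OF sub]
  have step: "E 0 *v (A *v e 1) = 3 *s e 0" "E 2 *v (A *v e 1) = 2 *s e 2"
      "E 1 *v (A *v e 2) = 2 *s e 1" "E 3 *v (A *v e 2) = 3 *s e 3"
    by (simp_all add: vec_eq)
  have 01: "e 1 \<in> U" if "e 0 \<in> U" using A[OF that] by (simp only: A_e)
  have 32: "e 2 \<in> U" if "e 3 \<in> U" using A[OF that] by (simp only: A_e)
  have 10: "e 0 \<in> U" if "e 1 \<in> U" using E[OF _ A[OF that], of 0] step(1) scale by simp
  have 12: "e 2 \<in> U" if "e 1 \<in> U" using E[OF _ A[OF that], of 2] step(2) scale by simp
  have 21: "e 1 \<in> U" if "e 2 \<in> U" using E[OF _ A[OF that], of 1] step(3) scale by simp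
  have 23: "e 3 \<in> U" if "e 2 \<in> U" using E[OF _ A[OF that], of 3] step(4) scale by simp
  have "e 0 \<in> U \<or> e 1 \<in> U \<or> e 2 \<in> U \<or> e 3 \<in> U"
    using i unfolding nat_le_3_iff by metis
  then have "{e 0, e 1, e 2, e 3} \<subseteq> U"
    using 01 32 10 12 21 23 by blast
  then show ?thesis unfolding W0_def using sub by (rule vec.span_minimal)
qed

lemma irreducible_W0: "irreducible_T_module adj x W0"
  unfolding irreducible_T_module_def
proof (intro conjI allI impI)
  have "e 0 \<in> W0" unfolding W0_def by (simp add: vec.span_base)
  then show "W0 \<noteq> {0}" using e_nonzero[of 0] by (metis le0 singletonD)
  fix U assume U: "T_module adj x U \<and> U \<subset> W0"
  then have sub: "vec.subspace U" and E: "\<And>u i. i \<le> 3 \<Longrightarrow> u \<in> U \<Longrightarrow> E i *v u \<in> U"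
    by (auto simp: T_module_iff)
  show "U = {0}"
  proof (rule ccontr)
    assume "U \<noteq> {0}"
    moreover have "0 \<in> U" using sub by (rule vec.subspace_0)
    ultimately obtain u where u: "u \<in> U" "u \<noteq> 0" by auto
    then have "u \<in> W0" using U by auto
    obtain y where y: "u $ y \<noteq> 0" using u(2) by (auto simp: vec_eq_iff)
    define i where "i = gdist adj x y"
    have "E i *v u = u $ y *s e i"
    proof (subst vec_eq_iff, intro allI)
      show "(E i *v u) $ y' = (u $ y *s e i) $ y'" for y'
        using W0_nth_eq[OF \<open>u \<in> W0\<close>, of y' y] by (cases "gdist adj x y' = i") (auto simp: i_def)
    qed
    moreover have "i \<le> 3" using gdist_le_diameter[of adj x y] by (simp add: i_def)
    ultimately obtain i c where i: "i \<le> 3" "c \<noteq> 0" "E i *v u = c *s e i" using y by blast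
    have "c *s e i \<in> U" using E[OF i(1) u(1)] i(3) by simp
    then have "e i \<in> U" using i(2) by (rule subspace_scaleD[OF sub])
    then have "W0 \<subseteq> U" using U i(1) W0_subset by blast
    then show False using U by blast
  qed
qed (rule T_module_W0)

text \<open>The vectors of the first layer orthogonal to \<open>e 1\<close>. Zero is among them, so
  nonvanishing is assumed separately.\<close>

definition seeds :: "(complex^'v) set" where
  "seeds = {\<nu>. \<nu> $ x = 0 \<and> \<nu> $ y1 + \<nu> $ y2 + \<nu> $ y3 = 0 \<and> \<nu> $ z1 = 0 \<and> \<nu> $ z2 = 0 \<and> \<nu> $ z3 = 0 \<and> \<nu> $ w = 0}"

context
  fixes \<nu> assumes \<nu>: "\<nu> \<in> seeds" "\<nu> \<noteq> 0"
begin

lemma seed_nth [simp]: "\<nu> $ x = 0" "\<nu> $ y3 = - (\<nu> $ y1 + \<nu> $ y2)" "\<nu> $ z1 = 0" "\<nu> $ z2 = 0" "\<nu> $ z3 = 0" "\<nu> $ w = 0"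
  using \<nu>(1) by (auto simp: seeds_def eq_neg_iff_add_eq_0 algebra_simps)

text \<open>Since the coordinates of \<open>\<nu>\<close> sum to 0, \<open>A *v \<nu>\<close> lives
  on the second layer, and its value at each \<open>z\<close> is the negative of the value of
  \<open>\<nu>\<close> at the antipodal \<open>y\<close>. The same happens on the way back, and the
  two signs cancel.\<close>

lemma AA_seed: "A *v (A *v \<nu>) = \<nu>"
  by (simp add: vec_eq)

lemma E_seed: "E i *v \<nu> = (if i = 1 then \<nu> else 0)" "E i *v (A *v \<nu>) = (if i = 2 then A *v \<nu> else 0)"
  by (simp_all add: vec_eq)

lemma A_seed_nonzero: "A *v \<nu> \<noteq> 0"
  using AA_seed \<nu>(2) by (metis matrix_vector_mult_0_right)

lemma seed_orthogonal: "herm_inner \<nu> (A *v \<nu>) = 0" "herm_inner (A *v \<nu>) \<nu> = 0"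
  by (simp_all add: herm_inner_def sum_vertices)

lemma seed_neq: "\<nu> \<noteq> A *v \<nu>"
  using seed_orthogonal \<nu>(2) herm_inner_self_eq_0_iff by metis

lemma independent_seed: "vec.independent {\<nu>, A *v \<nu>}"
  by (rule independent_orthogonal) (use \<nu>(2) A_seed_nonzero seed_orthogonal in auto)

lemma T_module_W1: "T_module adj x (W1 \<nu>)"
  unfolding W1_def
  by (rule T_module_span) (auto simp: AA_seed E_seed vec.span_zero intro: vec.span_base)

lemma W1_subset:
  assumes "T_module adj x U" "\<nu> \<in> U"
  shows "W1 \<nu> \<subseteq> U"
  unfolding W1_def using assms by (intro vec.span_minimal) (auto simp: T_module_iff)

lemma seed_in_W1: "\<nu> \<in> W1 \<nu>"
  unfolding W1_def by (simp add: vec.span_base)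

lemma irreducible_W1: "irreducible_T_module adj x (W1 \<nu>)"
  unfolding irreducible_T_module_def
proof (intro conjI allI impI)
  show "W1 \<nu> \<noteq> {0}" using \<nu>(2) seed_in_W1 by auto
  fix U assume U: "T_module adj x U \<and> U \<subset> W1 \<nu>"
  then have sub: "vec.subspace U" and A: "\<And>u. u \<in> U \<Longrightarrow> A *v u \<in> U"
    and E: "\<And>u i. i \<le> 3 \<Longrightarrow> u \<in> U \<Longrightarrow> E i *v u \<in> U"
    by (auto simp: T_module_iff)
  show "U = {0}"
  proof (rule ccontr)
    assume "U \<noteq> {0}"
    moreover have "0 \<in> U" using sub by (rule vec.subspace_0)
    ultimately obtain u where u: "u \<in> U" "u \<noteq> 0" by auto
    then have "u \<in> W1 \<nu>" using U by auto
    then obtain s t where st: "u = s *s \<nu> + t *s (A *v \<nu>)" by (auto simp: W1_def span_pair)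
    \<comment> \<open>The projections onto layers one and two recover the two components, and a
      further \<open>A\<close> returns the second to the line of \<open>\<nu>\<close>.\<close>
    have "s *s \<nu> = E 1 *v u" "t *s \<nu> = A *v (E 2 *v u)"
      by (simp_all add: st matrix_vector_right_distrib matrix_vector_smult E_seed AA_seed)
    then have "s *s \<nu> \<in> U" "t *s \<nu> \<in> U" using A E u(1) by auto
    moreover have "s \<noteq> 0 \<or> t \<noteq> 0" using st u(2) by auto
    ultimately have "\<exists>c. c \<noteq> 0 \<and> c *s \<nu> \<in> U" by auto
    then obtain c where c: "c \<noteq> 0" "c *s \<nu> \<in> U" by blast
    have "\<nu> \<in> U" by (rule subspace_scaleD[OF sub c(2,1)])
    then show False using W1_subset U by blast
  qed
qed (rule T_module_W1)

lemma module_layer_W1: "module_layer adj x (W1 \<nu>) i = (if i = 1 then vec.span {\<nu>} else if i = 2 then vec.span {A *v \<nu>} else {0})"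
  unfolding W1_def module_layer_span by (auto simp: E_seed insert_commute)

lemma module_support_W1: "module_support adj x (W1 \<nu>) = {1, 2}"
proof -
  have "i \<le> 3 \<and> module_layer adj x (W1 \<nu>) i \<noteq> {0} \<longleftrightarrow> i = 1 \<or> i = 2" for i
    unfolding module_layer_W1 using span_single_eq_0[OF \<nu>(2)] span_single_eq_0[OF A_seed_nonzero] by simp
  then show ?thesis unfolding module_support_def gdiameter by blast
qed

end

lemma module_layer_W0: "i \<le> 3 \<Longrightarrow> module_layer adj x W0 i = vec.span {e i}"
  unfolding W0_def module_layer_span by (auto simp: E_e nat_le_3_iff insert_commute)

lemma module_support_W0: "module_support adj x W0 = {0, 1, 2, 3}"
proof -
  have "i \<le> 3 \<and> module_layer adj x W0 i \<noteq> {0} \<longleftrightarrow> i \<le> 3" for i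
    using module_layer_W0[of i] span_single_eq_0[OF e_nonzero[of i]] by metis
  then show ?thesis unfolding module_support_def gdiameter nat_le_3_iff by blast
qed

end

lemma vector_4 [simp]:
  "(vector [a, b, c, d] :: 'a::zero^4) $ 1 = a"
  "(vector [a, b, c, d] :: 'a::zero^4) $ 2 = b"
  "(vector [a, b, c, d] :: 'a::zero^4) $ 3 = c"
  "(vector [a, b, c, d] :: 'a::zero^4) $ 4 = d"
  unfolding vector_def by simp_all

text \<open>In the index type 4 the numbers 4 and 0 coincide, so the last entry must also be known
  under the index 0.\<close>

lemma vector_4_0: "(vector [a, b, c, d] :: 'a::zero^4) $ 0 = d"
proof -
  have zero: "(0::4) = 4" by simp
  show ?thesis unfolding zero by (rule vector_4)
qed

lemma vector_2_0: "(vector [a, b] :: 'a::zero^2) $ 0 = b"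
proof -
  have zero: "(0::2) = 2" by simp
  show ?thesis unfolding zero by (rule vector_2)
qed

lemma pure_vectorI: "v \<noteq> 0 \<Longrightarrow> dual_idempotent adj x i *v v = v \<Longrightarrow> pure_vector adj x i v"
  unfolding pure_vector_def module_layer_def by (metis UNIV_I image_eqI)

lemma dim_span_single: "v \<noteq> 0 \<Longrightarrow> vec.dim (vec.span {v}) = 1" for v :: "complex^'n"
  by (simp add: vec.dim_eq_card_independent)

section \<open>Numerical data and isomorphism classes of the modules\<close>

context labelled_cube
begin

lemma dim_W0: "vec.dim W0 = 4"
  unfolding W0_def vec.dim_span vec.dim_eq_card_independent[OF independent_e]
  using e_neqs distinct_card[of "[e 0, e 1, e 2, e 3]"] by simp

lemma endpoint_W0: "endpoint adj x W0 = 0"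
  unfolding endpoint_def module_support_W0 by simp

lemma module_diameter_W0: "module_diameter adj x W0 = 3"
  unfolding module_diameter_def module_support_W0 by simp

lemma shape_W0: "shape adj x W0 = [1, 1, 1, 1]"
proof -
  have "vec.dim (module_layer adj x W0 i) = 1" if "i \<le> 3" for i
    using that by (simp add: module_layer_W0 dim_span_single e_nonzero)
  moreover have "[0..<0 + 3 + 1] = [0, 1, 2, 3::nat]" by (simp add: upt_rec One_nat_def)
  ultimately show ?thesis unfolding shape_def endpoint_W0 module_diameter_W0 by simp
qed

lemma pure_basis_W0: "pure_basis adj x [e 0, e 1, e 2, e 3] W0"
  unfolding pure_basis_def
proof
  show "is_basis [e 0, e 1, e 2, e 3] W0"
    unfolding is_basis_def using e_neqs independent_e by (simp add: W0_def)
  have "list_all2 (pure_vector adj x) [0, 1, 2, 3] [e 0, e 1, e 2, e 3]"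
    using e_nonzero by (auto intro!: pure_vectorI simp: E_e simp del: e_nth)
  then show "\<exists>is. sorted is \<and> list_all2 (pure_vector adj x) is [e 0, e 1, e 2, e 3]"
    by (intro exI[of _ "[0, 1, 2, 3]"]) simp
qed

lemma represents_W0:
  "represents A [e 0, e 1, e 2, e 3]
    (vector [vector [0, 3, 0, 0], vector [1, 0, 2, 0], vector [0, 2, 0, 1], vector [0, 0, 3, 0]] :: complex^4^4)"
proof -
  have len: "length [e 0, e 1, e 2, e 3] = 4" by simp
  have interval: "{1..4} = {1, 2, 3, 4::nat}" by auto
  show ?thesis
    unfolding represents_def len interval by (simp add: A_e nth_Cons' vector_4_0 del: e_nth)
qed

context
  fixes \<nu> assumes \<nu>: "\<nu> \<in> seeds" "\<nu> \<noteq> 0"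
begin

lemma dim_W1: "vec.dim (W1 \<nu>) = 2"
  unfolding W1_def vec.dim_span vec.dim_eq_card_independent[OF independent_seed[OF \<nu>]]
  using seed_neq[OF \<nu>] by simp

lemma endpoint_W1: "endpoint adj x (W1 \<nu>) = 1"
  unfolding endpoint_def module_support_W1[OF \<nu>] by simp

lemma module_diameter_W1: "module_diameter adj x (W1 \<nu>) = 1"
  unfolding module_diameter_def module_support_W1[OF \<nu>] by simp

lemma shape_W1: "shape adj x (W1 \<nu>) = [1, 1]"
proof -
  have "[1..<1 + 1 + 1] = [1, 2::nat]" by (simp add: upt_rec One_nat_def)
  then show ?thesis
    unfolding shape_def endpoint_W1 module_diameter_W1
    by (simp add: module_layer_W1[OF \<nu>] dim_span_single \<nu>(2) A_seed_nonzero[OF \<nu>] del: vec.dim_span)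
qed

lemma pure_vector_seed: "pure_vector adj x 1 \<nu>" "pure_vector adj x 2 (A *v \<nu>)"
  by (auto intro!: pure_vectorI simp: E_seed[OF \<nu>] \<nu>(2) A_seed_nonzero[OF \<nu>])

lemma pure_basis_W1: "pure_basis adj x [\<nu>, A *v \<nu>] (W1 \<nu>)"
  unfolding pure_basis_def
proof
  show "is_basis [\<nu>, A *v \<nu>] (W1 \<nu>)"
    unfolding is_basis_def using seed_neq[OF \<nu>] independent_seed[OF \<nu>] by (simp add: W1_def)
  show "\<exists>is. sorted is \<and> list_all2 (pure_vector adj x) is [\<nu>, A *v \<nu>]"
    using pure_vector_seed by (intro exI[of _ "[1, 2]"]) simp
qed

lemma represents_W1:
  "represents A [\<nu>, A *v \<nu>] (vector [vector [0, 1], vector [1, 0]] :: complex^2^2)"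
proof -
  have len: "length [\<nu>, A *v \<nu>] = 2" by simp
  have interval: "{1..2} = {1, 2::nat}" by auto
  show ?thesis
    unfolding represents_def len interval by (simp add: AA_seed[OF \<nu>] nth_Cons' vector_2_0)
qed

text \<open>Layer 0 is nonzero in \<open>W0\<close> and zero in \<open>W1 \<nu>\<close>. Both
  directions are stated, because multiplicities compare a varying summand on the left with a fixed
  module on the right.\<close>

lemma not_isomorphic_W0_W1: "\<not> T_isomorphic adj x W0 (W1 \<nu>)"
  using T_isomorphic_module_layer[OF _ T_module_W0, of "W1 \<nu>" 0] module_layer_W0[of 0]
    span_single_eq_0[OF e_nonzero[of 0]] module_layer_W1[OF \<nu>, of 0] by auto

lemma not_isomorphic_W1_W0: "\<not> T_isomorphic adj x (W1 \<nu>) W0"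
  using T_isomorphic_module_layer[OF _ T_module_W1[OF \<nu>], of W0 0] module_layer_W0[of 0]
    span_single_eq_0[OF e_nonzero[of 0]] module_layer_W1[OF \<nu>, of 0] by auto

end

lemma T_isomorphic_W0: "T_isomorphic adj x W0 W0"
  unfolding T_isomorphic_def by (intro exI[of _ "\<lambda>u. u"]) (auto simp: bij_betw_def)

text \<open>In both modules \<open>A\<close> swaps the two basis vectors and the \<open>E i\<close>
  act alike on them, so matching the bases commutes with the generators.\<close>

lemma isomorphic_W1:
  assumes \<nu>: "\<nu> \<in> seeds" "\<nu> \<noteq> 0" and \<mu>: "\<mu> \<in> seeds" "\<mu> \<noteq> 0"
  shows "T_isomorphic adj x (W1 \<nu>) (W1 \<mu>)"
proof -
  obtain g where g: "Vector_Spaces.linear (*s) (*s) g"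
    "\<forall>v\<in>{\<nu>, A *v \<nu>}. g v = (if v = \<nu> then \<mu> else A *v \<mu>)"
    using vec.linear_independent_extend[OF independent_seed[OF \<nu>], of "\<lambda>v. if v = \<nu> then \<mu> else A *v \<mu>"]
    by blast
  have add: "g (u + v) = g u + g v" and scale: "g (c *s u) = c *s g u" for u v c
    using g(1) unfolding Vector_Spaces.linear_iff by auto
  have g0: "g 0 = 0" using scale[of 0 0] by simp
  have gv: "g \<nu> = \<mu>" "g (A *v \<nu>) = A *v \<mu>" using g(2) seed_neq[OF \<nu>] by auto
  have gst: "g (s *s \<nu> + t *s (A *v \<nu>)) = s *s \<mu> + t *s (A *v \<mu>)" for s t
    by (simp add: add scale gv)
  \<comment> \<open>The two vectors lie in different layers, so projecting separates their
    coefficients.\<close>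
  have inj: "s = 0 \<and> t = 0" if "s *s \<mu> + t *s (A *v \<mu>) = 0" for s t
  proof -
    have "E 1 *v (s *s \<mu> + t *s (A *v \<mu>)) = s *s \<mu>" "E 2 *v (s *s \<mu> + t *s (A *v \<mu>)) = t *s (A *v \<mu>)"
      by (simp_all add: matrix_vector_right_distrib matrix_vector_smult E_seed[OF \<mu>])
    then show ?thesis using that \<mu>(2) A_seed_nonzero[OF \<mu>] by simp
  qed
  show ?thesis
  proof (rule T_isomorphicI[where f = g])
    show "bij_betw g (W1 \<nu>) (W1 \<mu>)"
      unfolding bij_betw_def
    proof
      show "inj_on g (W1 \<nu>)"
      proof (rule inj_onI)
        fix u v assume uv: "u \<in> W1 \<nu>" "v \<in> W1 \<nu>" "g u = g v"
        have "u - v \<in> W1 \<nu>" using uv(1,2) unfolding W1_def by (rule vec.span_diff)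
        then obtain s t where st: "u - v = s *s \<nu> + t *s (A *v \<nu>)" by (auto simp: W1_def span_pair)
        have "g u = g (u - v) + g v" by (simp flip: add)
        then have "g (u - v) = 0" using uv(3) by simp
        then have "s = 0 \<and> t = 0" unfolding st gst by (rule inj)
        then show "u = v" using st by simp
      qed
      show "g ` W1 \<nu> = W1 \<mu>"
        unfolding W1_def span_pair by (force simp: gst image_iff)
    qed
    show "g (A *v u) = A *v g u" if "u \<in> W1 \<nu>" for u
      using that unfolding W1_def span_pair
      by (auto simp: matrix_vector_right_distrib matrix_vector_smult add scale gv AA_seed[OF \<nu>] AA_seed[OF \<mu>])
    show "g (E i *v u) = E i *v g u" if "u \<in> W1 \<nu>" for u i
      using that unfolding W1_def span_pair
      by (auto simp: matrix_vector_right_distrib matrix_vector_smult add scale gv g0 E_seed[OF \<nu>] E_seed[OF \<mu>])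
  qed (rule T_module_W1[OF \<nu>] add scale)+
qed

lemma irreducible_eqI:
  assumes "irreducible_T_module adj x U" "T_module adj x W" "W \<subseteq> U" "W \<noteq> {0}"
  shows "U = W"
  using assms unfolding irreducible_T_module_def by blast

section \<open>Arbitrary orthogonal decompositions\<close>

context
  fixes \<W> assumes dec: "orthogonal_decomposition adj x \<W>"
begin

lemma decomposition_irreducible: "U \<in> \<W> \<Longrightarrow> irreducible_T_module adj x U"
  and decomposition_orthogonal:
    "U \<in> \<W> \<Longrightarrow> W \<in> \<W> \<Longrightarrow> U \<noteq> W \<Longrightarrow> u \<in> U \<Longrightarrow> v \<in> W \<Longrightarrow> herm_inner u v = 0"
  and decomposition_finite: "finite \<W>"
  using dec unfolding orthogonal_decomposition_def by auto

lemma decomposition_sum: "\<exists>g. (\<forall>W\<in>\<W>. g W \<in> W) \<and> v = (\<Sum>W\<in>\<W>. g W)"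
proof -
  have "v \<in> {\<Sum>W\<in>\<W>. g W | g. \<forall>W\<in>\<W>. g W \<in> W}"
    using dec unfolding orthogonal_decomposition_def by simp
  then show ?thesis by blast
qed

text \<open>Layer 0 is the line through \<open>e 0\<close>, so a summand in which the component of
  \<open>e 0\<close> does not vanish at \<open>x\<close> contains \<open>e 0\<close> itself, hence
  \<open>W0\<close>; irreducibility gives equality.\<close>

lemma W0_in_decomposition: "W0 \<in> \<W>"
proof -
  obtain g where g: "\<forall>W\<in>\<W>. g W \<in> W" "e 0 = (\<Sum>W\<in>\<W>. g W)" using decomposition_sum by blast
  have "(\<Sum>W\<in>\<W>. g W $ x) = e 0 $ x" unfolding g(2) by simp
  then have "(\<Sum>W\<in>\<W>. g W $ x) \<noteq> 0" by simp
  then obtain W where W: "W \<in> \<W>" "g W $ x \<noteq> 0" by (meson sum.neutral)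
  have T: "T_module adj x W" using decomposition_irreducible[OF W(1)] by (simp add: irreducible_T_module_def)
  then have "E 0 *v g W \<in> W" using g(1) W(1) by (auto simp: T_module_iff)
  moreover have "E 0 *v g W = g W $ x *s e 0" by (simp add: vec_eq)
  ultimately have "e 0 \<in> W" using W(2) T subspace_scaleD[of W "g W $ x" "e 0"] by (simp add: T_module_iff)
  then have "W0 \<subseteq> W" using W0_subset[OF T, of 0] by simp
  then have "W = W0"
    using irreducible_eqI[OF decomposition_irreducible[OF W(1)] T_module_W0] irreducible_W0
    by (simp add: irreducible_T_module_def)
  then show ?thesis using W(1) by simp
qed

text \<open>Orthogonality to \<open>W0\<close> makes the coordinates of every \<open>u\<close> in
  \<open>U\<close> sum to 0 on each layer, so a seed can be extracted from any nonzero
  \<open>u\<close>.\<close>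

lemma decomposition_W1:
  assumes U: "U \<in> \<W>" "U \<noteq> W0"
  shows "\<exists>\<nu>. \<nu> \<in> seeds \<and> \<nu> \<noteq> 0 \<and> U = W1 \<nu>"
proof -
  have irr: "irreducible_T_module adj x U" using U(1) by (rule decomposition_irreducible)
  then have T: "T_module adj x U" by (simp add: irreducible_T_module_def)
  have sub: "vec.subspace U" and A: "\<And>u. u \<in> U \<Longrightarrow> A *v u \<in> U"
    and E: "\<And>u i. i \<le> 3 \<Longrightarrow> u \<in> U \<Longrightarrow> E i *v u \<in> U"
    using T by (auto simp: T_module_iff)
  have "U \<noteq> {0}" using irr by (simp add: irreducible_T_module_def)
  then obtain u where u: "u \<in> U" "u \<noteq> 0" using vec.subspace_0[OF sub] by auto
  have orth: "herm_inner u b = 0" if "b \<in> {e 0, e 1, e 2, e 3}" for b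
    using decomposition_orthogonal[OF U(1) W0_in_decomposition U(2) u(1), of b] that
    unfolding W0_def by (blast intro: vec.span_base)
  have u0: "u $ x = 0" "u $ y1 + u $ y2 + u $ y3 = 0" "u $ z1 + u $ z2 + u $ z3 = 0" "u $ w = 0"
    using orth[of "e 0"] orth[of "e 1"] orth[of "e 2"] orth[of "e 3"]
    by (simp_all add: herm_inner_def sum_vertices)
  have "\<exists>\<nu>\<in>U. \<nu> \<in> seeds \<and> \<nu> \<noteq> 0"
  proof (cases "E 1 *v u = 0")
    case False
    have "E 1 *v u \<in> seeds" unfolding seeds_def using u0(2) by simp
    moreover have "E 1 *v u \<in> U" using u(1) by (intro E) auto
    ultimately show ?thesis using False by blast
  next
    \<comment> \<open>Now \<open>u\<close> is supported on the second layer, and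
      \<open>A *v u\<close> has the negatives of its coordinates at the antipodal \<open>y\<close>;
      so it is a seed and does not vanish.\<close>
    case True
    then have y: "u $ y1 = 0" "u $ y2 = 0" "u $ y3 = 0" by (simp_all add: vec_eq)
    have z3: "u $ z3 = - (u $ z1 + u $ z2)" using u0(3) by (simp add: eq_neg_iff_add_eq_0 algebra_simps)
    have "A *v u \<in> seeds" unfolding seeds_def by (simp add: z3 y u0(1,4))
    moreover have "A *v u \<noteq> 0" using u(2) by (auto simp: vec_eq z3 y u0(1,4))
    ultimately show ?thesis using A u(1) by blast
  qed
  then obtain \<nu> where \<nu>: "\<nu> \<in> U" "\<nu> \<in> seeds" "\<nu> \<noteq> 0" by blast
  have "U = W1 \<nu>"
    using W1_subset[OF \<nu>(2,3) T \<nu>(1)] seed_in_W1[OF \<nu>(2,3)] \<nu>(3)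
    by (intro irreducible_eqI[OF irr T_module_W1[OF \<nu>(2,3)]]) auto
  then show ?thesis using \<nu> by blast
qed

text \<open>The first layers of the summands are lines, and these are orthogonal and fill the
  three-dimensional first layer of the whole space.\<close>

lemma card_decomposition: "card \<W> = 3"
proof -
  have "\<exists>v. v \<in> U \<and> v \<noteq> 0 \<and> E 1 *v v = v \<and> (\<forall>u\<in>U. E 1 *v u \<in> vec.span {v})" if "U \<in> \<W>" for U
  proof (cases "U = W0")
    case True
    have "e 1 \<in> W0" unfolding W0_def by (simp add: vec.span_base del: e_nth)
    moreover have "\<forall>u\<in>W0. E 1 *v u \<in> vec.span {e 1}"
      using module_layer_W0[of 1] by (auto simp: module_layer_def)
    ultimately show ?thesis using True e_nonzero[of 1] E_e[of 1 1] by auto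
  next
    case False
    then obtain \<nu> where \<nu>: "\<nu> \<in> seeds" "\<nu> \<noteq> 0" "U = W1 \<nu>" using decomposition_W1[OF \<open>U \<in> \<W>\<close>] by blast
    then have "\<forall>u\<in>U. E 1 *v u \<in> vec.span {\<nu>}"
      using module_layer_W1[OF \<nu>(1,2), of 1] by (auto simp: module_layer_def)
    then show ?thesis using \<nu> seed_in_W1 E_seed(1)[OF \<nu>(1,2), of 1] by auto
  qed
  then obtain n where n: "\<And>U. U \<in> \<W> \<Longrightarrow> n U \<in> U" "\<And>U. U \<in> \<W> \<Longrightarrow> n U \<noteq> 0"
    "\<And>U. U \<in> \<W> \<Longrightarrow> E 1 *v n U = n U" "\<And>U u. U \<in> \<W> \<Longrightarrow> u \<in> U \<Longrightarrow> E 1 *v u \<in> vec.span {n U}"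
    by metis
  have orth: "herm_inner (n U) (n W) = 0" if "U \<in> \<W>" "W \<in> \<W>" "U \<noteq> W" for U W
    using decomposition_orthogonal[OF that] n(1) that by blast
  have inj: "inj_on n \<W>"
    using orth n(2) herm_inner_self_eq_0_iff by (metis inj_onI)
  have indep: "vec.independent (n ` \<W>)"
    by (rule independent_orthogonal) (use decomposition_finite n(2) orth in auto)
  define L where "L = {v. E 1 *v v = v}"
  have "L \<subseteq> vec.span (n ` \<W>)"
  proof
    fix v assume "v \<in> L"
    obtain g where g: "\<forall>W\<in>\<W>. g W \<in> W" "v = (\<Sum>W\<in>\<W>. g W)" using decomposition_sum by blast
    \<comment> \<open>Projecting the components in the summands keeps the sum and puts each of them
      on its line.\<close>
    have "v = E 1 *v v" using \<open>v \<in> L\<close> by (simp add: L_def)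
    also have "\<dots> = (\<Sum>W\<in>\<W>. E 1 *v g W)" unfolding g(2) by (rule vec.sum)
    also have "\<dots> \<in> vec.span (n ` \<W>)"
    proof (rule vec.span_sum)
      fix W assume W: "W \<in> \<W>"
      have "vec.span {n W} \<subseteq> vec.span (n ` \<W>)" using W by (intro vec.span_mono) auto
      then show "E 1 *v g W \<in> vec.span (n ` \<W>)" using n(4)[OF W] g(1) W by blast
    qed
    finally show "v \<in> vec.span (n ` \<W>)" .
  qed
  moreover have "n ` \<W> \<subseteq> L" using n(3) by (auto simp: L_def)
  ultimately have 1: "vec.dim L = card \<W>"
    using vec.dim_unique[OF _ _ indep] card_image[OF inj] by blast
  let ?B = "{axis y1 1, axis y2 1, axis y3 1} :: (complex^'v) set"
  have neqs: "axis y1 1 \<noteq> (axis y2 1 :: complex^'v)" "axis y1 1 \<noteq> (axis y3 1 :: complex^'v)"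
    "axis y2 1 \<noteq> (axis y3 1 :: complex^'v)" by (simp_all add: axis_eq_axis)
  have "vec.dim L = 3"
  proof (rule vec.dim_unique)
    show "?B \<subseteq> L" by (auto simp: L_def vec_eq axis_def)
    show "L \<subseteq> vec.span ?B"
    proof
      fix v assume "v \<in> L"
      then have "v = v $ y1 *s axis y1 1 + v $ y2 *s axis y2 1 + v $ y3 *s axis y3 1"
        by (simp add: L_def vec_eq axis_def)
      also have "\<dots> \<in> vec.span ?B" by (intro vec.span_add vec.span_scale vec.span_base) auto
      finally show "v \<in> vec.span ?B" .
    qed
    show "vec.independent ?B"
      by (rule vec.independent_mono[OF independent_cart_basis]) (auto simp: cart_basis_def)
  qed (use neqs in simp)
  then show ?thesis using 1 by simp
qed

lemma decomposition_isomorphic_W0: "card {U \<in> \<W>. T_isomorphic adj x U W0} = 1"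
proof -
  have "{U \<in> \<W>. T_isomorphic adj x U W0} = {W0}"
    using W0_in_decomposition decomposition_W1 not_isomorphic_W1_W0 T_isomorphic_W0 by blast
  then show ?thesis by simp
qed

lemma decomposition_isomorphic_W1:
  assumes "\<nu> \<in> seeds" "\<nu> \<noteq> 0"
  shows "card {U \<in> \<W>. T_isomorphic adj x U (W1 \<nu>)} = 2"
proof -
  have "{U \<in> \<W>. T_isomorphic adj x U (W1 \<nu>)} = \<W> - {W0}"
    using decomposition_W1 not_isomorphic_W0_W1[OF assms] isomorphic_W1[OF _ _ assms] by blast
  then show ?thesis
    using card_decomposition W0_in_decomposition decomposition_finite by simp
qed

end

text \<open>The given decomposition provides existence for the definite description; uniqueness is
  that every decomposition yields the same count.\<close>

lemma multiplicity_W0: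
  assumes "orthogonal_decomposition adj x \<W>"
  shows "multiplicity_of adj x W0 = 1"
  unfolding multiplicity_of_def using assms decomposition_isomorphic_W0 by (intro the_equality) blast+

lemma multiplicity_W1:
  assumes "orthogonal_decomposition adj x \<W>" "\<nu> \<in> seeds" "\<nu> \<noteq> 0"
  shows "multiplicity_of adj x (W1 \<nu>) = 2"
  unfolding multiplicity_of_def
  using assms decomposition_isomorphic_W1[OF _ assms(2,3)] by (intro the_equality) blast+

section \<open>The explicit decomposition\<close>

definition seed_a :: "complex^'v" where
  "seed_a = (\<chi> u. if u = y1 then 1 else if u = y2 then -1 else 0)"

text \<open>Together with \<open>seed_a\<close> an orthogonal basis of \<open>seeds\<close>; the
  squared norms are 6 and 2.\<close>

definition seed_b :: "complex^'v" where
  "seed_b = (\<chi> u. if u = y1 then 1 else if u = y2 then 1 else if u = y3 then -2 else 0)"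

lemma seed_nths [simp]:
  "seed_a $ x = 0" "seed_a $ y1 = 1" "seed_a $ y2 = -1" "seed_a $ y3 = 0"
  "seed_a $ z1 = 0" "seed_a $ z2 = 0" "seed_a $ z3 = 0" "seed_a $ w = 0"
  "seed_b $ x = 0" "seed_b $ y1 = 1" "seed_b $ y2 = 1" "seed_b $ y3 = -2"
  "seed_b $ z1 = 0" "seed_b $ z2 = 0" "seed_b $ z3 = 0" "seed_b $ w = 0"
  by (simp_all add: seed_a_def seed_b_def)

lemma seed_a: "seed_a \<in> seeds" "seed_a \<noteq> 0"
  and seed_b: "seed_b \<in> seeds" "seed_b \<noteq> 0"
  unfolding seeds_def
  by (simp_all add: vec_eq)

text \<open>By sesquilinearity only generators have to be compared, and conjugate symmetry halves
  the cases.\<close>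

lemma orthogonal_modules:
  assumes "U \<in> {W0, W1 seed_a, W1 seed_b}" "W \<in> {W0, W1 seed_a, W1 seed_b}" "U \<noteq> W" "u \<in> U" "v \<in> W"
  shows "herm_inner u v = 0"
proof -
  have 0: "herm_inner u v = 0" if "u \<in> W0" "v \<in> W1 \<nu>" "\<nu> \<in> {seed_a, seed_b}" for u v \<nu>
    by (rule herm_inner_span[OF _ that(1,2)[unfolded W0_def W1_def]])
      (use that(3) in \<open>auto simp: herm_inner_def sum_vertices\<close>)
  have 1: "herm_inner u v = 0" if "u \<in> W1 seed_a" "v \<in> W1 seed_b" for u v
    by (rule herm_inner_span[OF _ that[unfolded W1_def]])
      (auto simp: herm_inner_def sum_vertices)
  have "herm_inner u v = 0 \<or> herm_inner v u = 0"
    using assms 0[of u v] 0[of v u] 1[of u v] 1[of v u] by blast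
  then show ?thesis using herm_inner_commute[of u v] by auto
qed

lemma distinct_modules: "distinct [W0, W1 seed_a, W1 seed_b]"
proof -
  have "W1 seed_a \<noteq> W0" "W1 seed_b \<noteq> W0"
    using dim_W0 dim_W1[OF seed_a] dim_W1[OF seed_b] by auto
  moreover have "W1 seed_a \<noteq> W1 seed_b"
  proof
    \<comment> \<open>Then \<open>seed_a\<close> would be orthogonal to itself.\<close>
    assume *: "W1 seed_a = W1 seed_b"
    have "herm_inner seed_a seed_b = 0" by (simp add: herm_inner_def sum_vertices)
    moreover have "herm_inner seed_a (A *v seed_b) = 0"
      by (simp add: herm_inner_def sum_vertices)
    ultimately have "herm_inner seed_a v = 0" if "v \<in> W1 seed_b" for v
      using that unfolding W1_def by (intro herm_inner_span[of "{seed_a}" _ seed_a v]) (auto intro: vec.span_base)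
    then have "herm_inner seed_a seed_a = 0" using seed_in_W1[OF seed_a] * by simp
    then show False using seed_a(2) by (simp add: herm_inner_self_eq_0_iff)
  qed
  ultimately show ?thesis by auto
qed

lemma decomposition: "orthogonal_decomposition adj x {W0, W1 seed_a, W1 seed_b}"
  unfolding orthogonal_decomposition_def
proof (intro conjI)
  show "\<forall>W\<in>{W0, W1 seed_a, W1 seed_b}. irreducible_T_module adj x W"
    using irreducible_W0 irreducible_W1[OF seed_a] irreducible_W1[OF seed_b] by blast
  show "\<forall>U\<in>{W0, W1 seed_a, W1 seed_b}. \<forall>W\<in>{W0, W1 seed_a, W1 seed_b}. U \<noteq> W \<longrightarrow>
      (\<forall>u\<in>U. \<forall>w\<in>W. herm_inner u w = 0)"
    using orthogonal_modules by blast
  have "\<exists>g. v = (\<Sum>W\<in>{W0, W1 seed_a, W1 seed_b}. g W) \<and> (\<forall>W\<in>{W0, W1 seed_a, W1 seed_b}. g W \<in> W)" for v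
  proof -
    \<comment> \<open>The orthogonal projections of \<open>v\<close>: layer means for
      \<open>W0\<close>, and otherwise inner products with the basis vectors divided by their
      squared norms 2 and 6.\<close>
    define a where "a = v $ x *s e 0 + ((v $ y1 + v $ y2 + v $ y3) / 3) *s e 1
      + ((v $ z1 + v $ z2 + v $ z3) / 3) *s e 2 + v $ w *s e 3"
    define b where "b = ((v $ y1 - v $ y2) / 2) *s seed_a + ((v $ z2 - v $ z1) / 2) *s (A *v seed_a)"
    define c where "c = ((v $ y1 + v $ y2 - 2 * v $ y3) / 6) *s seed_b
      + ((2 * v $ z3 - v $ z1 - v $ z2) / 6) *s (A *v seed_b)"
    have "a \<in> W0" unfolding a_def W0_def
      by (intro vec.span_add vec.span_scale vec.span_base) auto
    moreover have "b \<in> W1 seed_a" "c \<in> W1 seed_b" unfolding b_def c_def W1_def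
      by (intro vec.span_add vec.span_scale vec.span_base; simp)+
    moreover have "v = a + b + c"
      unfolding vec_eq by (simp add: a_def b_def c_def field_simps)
    ultimately show ?thesis
      using distinct_modules
      by (intro exI[of _ "\<lambda>W. if W = W0 then a else if W = W1 seed_a then b else c"]) (auto simp: add.assoc)
  qed
  then show "{\<Sum>W\<in>{W0, W1 seed_a, W1 seed_b}. g W | g. \<forall>W\<in>{W0, W1 seed_a, W1 seed_b}. g W \<in> W} = UNIV"
    by blast
qed simp

end

lemma cmat_sum_nth: "(\<Sum>i\<in>I. f i) $ p $ q = (\<Sum>i\<in>I. f i $ p $ q)" for f :: "'i \<Rightarrow> complex^'n^'m"
  by simp

subsection \<open>The dimension of the Terwilliger algebra\<close>

text \<open>The indicator matrices of the fibres of \<open>k\<close> form a basis. Only attained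
  values are counted, since an empty fibre has the zero matrix as its indicator.\<close>

lemma dim_fibre_constant_matrices:
  fixes k :: "'m::finite \<Rightarrow> 'n::finite \<Rightarrow> 'k"
  shows "cmat.dim {M :: complex^'n^'m. \<exists>g. \<forall>p q. M $ p $ q = g (k p q)} = card (range (\<lambda>(p, q). k p q))"
    (is "cmat.dim ?C = _")
proof -
  define K where "K = range (\<lambda>(p, q). k p q)"
  have fin: "finite K" and k: "k p q \<in> K" for p q by (auto simp: K_def)
  define b :: "'k \<Rightarrow> complex^'n^'m" where "b i = (\<chi> p q. if k p q = i then 1 else 0)" for i
  have b: "b i $ p $ q = (if k p q = i then 1 else 0)" for i p q by (simp add: b_def)
  have inj: "inj_on b K"
  proof (rule inj_onI)
    fix i j assume "i \<in> K" "j \<in> K" "b i = b j"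
    then obtain p q where "k p q = i" by (auto simp: K_def)
    then have "b j $ p $ q = 1" using b[of i p q] \<open>b i = b j\<close> by simp
    then show "i = j" using b[of j p q] \<open>k p q = i\<close> by (auto split: if_splits)
  qed
  have combination: "(\<Sum>i\<in>K. smult_matrix (c i) (b i)) $ p $ q = c (k p q)" for c p q
  proof -
    have "(\<Sum>i\<in>K. smult_matrix (c i) (b i)) $ p $ q = (\<Sum>i\<in>K. if k p q = i then c i else 0)"
      unfolding cmat_sum_nth by (intro sum.cong) (auto simp: b)
    also have "\<dots> = c (k p q)" using fin k by (subst sum.delta') auto
    finally show ?thesis .
  qed
  have indep: "\<not> cmat.dependent (b ` K)"
  proof
    assume "cmat.dependent (b ` K)"
    then obtain u where u: "\<exists>v\<in>b ` K. u v \<noteq> 0" "(\<Sum>v\<in>b ` K. smult_matrix (u v) v) = 0"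
      using cmat.dependent_finite[of "b ` K"] fin by auto
    have "(\<Sum>i\<in>K. smult_matrix (u (b i)) (b i)) = 0"
      using u(2) by (simp add: sum.reindex[OF inj])
    then have "u (b (k p q)) = 0" for p q using combination[of "\<lambda>i. u (b i)" p q] by simp
    then show False using u(1) by (auto simp: K_def)
  qed
  have "b i \<in> ?C" for i
    using b[of i] by (intro CollectI exI[of _ "\<lambda>j. if j = i then 1 else 0"] allI)
  then have "b ` K \<subseteq> ?C" by blast
  moreover have "?C \<subseteq> cmat.span (b ` K)"
  proof
    fix M :: "complex^'n^'m" assume "M \<in> ?C"
    then obtain g where g: "\<forall>p q. M $ p $ q = g (k p q)" by blast
    have "M = (\<Sum>i\<in>K. smult_matrix (g i) (b i))"
      unfolding vec_eq_iff combination using g by blast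
    also have "\<dots> \<in> cmat.span (b ` K)"
      by (intro cmat.span_sum cmat.span_scale cmat.span_base) auto
    finally show "M \<in> cmat.span (b ` K)" .
  qed
  ultimately show ?thesis
    unfolding K_def[symmetric] by (rule cmat.dim_unique[OF _ _ indep card_image[OF inj]])
qed

lemma dual_idempotent_mult_nth:
  "(dual_idempotent adj x i ** M ** dual_idempotent adj x j) $ p $ q =
    (if gdist adj x p = i \<and> gdist adj x q = j then M $ p $ q else 0)"
proof -
  have "(dual_idempotent adj x i ** M) $ p $ q = (if gdist adj x p = i then M $ p $ q else 0)" for p q
    by (simp add: matrix_matrix_mult_def dual_idempotent_def if_distrib[of "\<lambda>c. c * _"] cong: if_cong)
  then have "(dual_idempotent adj x i ** M ** dual_idempotent adj x j) $ p $ q =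
      (\<Sum>u\<in>UNIV. (if gdist adj x p = i then M $ p $ u else 0) * (if u = q \<and> gdist adj x u = j then 1 else 0))"
    by (simp add: matrix_matrix_mult_def[of "_ ** _"] dual_idempotent_def)
  also have "\<dots> = (\<Sum>u\<in>UNIV. if u = q then (if gdist adj x p = i \<and> gdist adj x q = j then M $ p $ q else 0) else 0)"
    by (intro sum.cong) auto
  finally show ?thesis by simp
qed

section \<open>The Terwilliger algebra as the matrices constant on distance triples\<close>

context labelled_cube
begin

lemma gdist_table:
  "gdist adj x x = 0" "gdist adj x y1 = 1" "gdist adj x y2 = 1" "gdist adj x y3 = 1" "gdist adj x z1 = 2" "gdist adj x z2 = 2" "gdist adj x z3 = 2" "gdist adj x w = 3"
  "gdist adj y1 x = 1" "gdist adj y1 y1 = 0" "gdist adj y1 y2 = 2" "gdist adj y1 y3 = 2" "gdist adj y1 z1 = 3" "gdist adj y1 z2 = 1" "gdist adj y1 z3 = 1" "gdist adj y1 w = 2"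
  "gdist adj y2 x = 1" "gdist adj y2 y1 = 2" "gdist adj y2 y2 = 0" "gdist adj y2 y3 = 2" "gdist adj y2 z1 = 1" "gdist adj y2 z2 = 3" "gdist adj y2 z3 = 1" "gdist adj y2 w = 2"
  "gdist adj y3 x = 1" "gdist adj y3 y1 = 2" "gdist adj y3 y2 = 2" "gdist adj y3 y3 = 0" "gdist adj y3 z1 = 1" "gdist adj y3 z2 = 1" "gdist adj y3 z3 = 3" "gdist adj y3 w = 2"
  "gdist adj z1 x = 2" "gdist adj z1 y1 = 3" "gdist adj z1 y2 = 1" "gdist adj z1 y3 = 1" "gdist adj z1 z1 = 0" "gdist adj z1 z2 = 2" "gdist adj z1 z3 = 2" "gdist adj z1 w = 1"
  "gdist adj z2 x = 2" "gdist adj z2 y1 = 1" "gdist adj z2 y2 = 3" "gdist adj z2 y3 = 1" "gdist adj z2 z1 = 2" "gdist adj z2 z2 = 0" "gdist adj z2 z3 = 2" "gdist adj z2 w = 1"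
  "gdist adj z3 x = 2" "gdist adj z3 y1 = 1" "gdist adj z3 y2 = 1" "gdist adj z3 y3 = 3" "gdist adj z3 z1 = 2" "gdist adj z3 z2 = 2" "gdist adj z3 z3 = 0" "gdist adj z3 w = 1"
  "gdist adj w x = 3" "gdist adj w y1 = 2" "gdist adj w y2 = 2" "gdist adj w y3 = 2" "gdist adj w z1 = 1" "gdist adj w z2 = 1" "gdist adj w z3 = 1" "gdist adj w w = 0"
  by (simp_all add: gdist_ham ham_def bits)

definition triangle :: "'v \<Rightarrow> 'v \<Rightarrow> nat \<times> nat \<times> nat" where
  "triangle p q = (gdist adj x p, gdist adj x q, gdist adj p q)"

text \<open>Up to permuting coordinates, a pair of vertices is a multiset of three bit pairs out of
  four, and the three distances determine how often each bit pair occurs. There are 6 choose 3, that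
  is 20, such multisets; here the triples are simply listed.\<close>

lemma card_triangle: "card (range (\<lambda>(p, q). triangle p q)) = 20"
proof -
  have "range (\<lambda>(p, q). triangle p q) = (\<Union>p\<in>UNIV. \<Union>q\<in>UNIV. {triangle p q})" by force
  also have "\<dots> = {(0,0,0), (0,1,1), (0,2,2), (0,3,3), (1,0,1), (1,1,0), (1,1,2), (1,2,1), (1,2,3), (1,3,2),
      (2,0,2), (2,1,1), (2,1,3), (2,2,0), (2,2,2), (2,3,1), (3,0,3), (3,1,2), (3,2,1), (3,3,0)}"
    unfolding vertices by (simp add: triangle_def gdist_table) auto
  finally show ?thesis by simp
qed

text \<open>Exchange of the first two coordinates; antipodal vertices move together. With
  \<open>reflection23\<close> it generates the symmetric group on the coordinates, which is the
  stabiliser of \<open>x\<close>.\<close>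

definition reflection12 :: "'v \<Rightarrow> 'v" where
  "reflection12 = id(y1 := y2, y2 := y1, z1 := z2, z2 := z1)"

definition reflection23 :: "'v \<Rightarrow> 'v" where
  "reflection23 = id(y2 := y3, y3 := y2, z2 := z3, z3 := z2)"

text \<open>Invariance holds for the generators and passes to a product by reindexing the sum over
  the middle vertex along \<open>\<sigma>\<close>.\<close>

lemma terwilliger_algebra_automorphism:
  assumes "bij \<sigma>" and adj: "\<And>u v. adj (\<sigma> u) (\<sigma> v) \<longleftrightarrow> adj u v"
    and dist: "\<And>u. gdist adj x (\<sigma> u) = gdist adj x u"
    and M: "M \<in> terwilliger_algebra adj x"
  shows "M $ \<sigma> p $ \<sigma> q = M $ p $ q"
proof -
  have inj: "\<sigma> u = \<sigma> v \<longleftrightarrow> u = v" for u v using \<open>bij \<sigma>\<close> by (simp add: bij_def inj_eq)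
  have "\<forall>p q. M $ \<sigma> p $ \<sigma> q = M $ p $ q"
    using M
  proof (induction rule: terwilliger_algebra_induct)
    case (mult M N)
    have "(M ** N) $ \<sigma> p $ \<sigma> q = (M ** N) $ p $ q" for p q
    proof -
      have "(M ** N) $ \<sigma> p $ \<sigma> q = (\<Sum>u\<in>UNIV. M $ \<sigma> p $ u * N $ u $ \<sigma> q)"
        by (simp add: matrix_matrix_mult_def)
      also have "\<dots> = (\<Sum>u\<in>UNIV. M $ \<sigma> p $ \<sigma> u * N $ \<sigma> u $ \<sigma> q)"
        using sum.reindex_bij_betw[OF \<open>bij \<sigma>\<close>, of "\<lambda>u. M $ \<sigma> p $ u * N $ u $ \<sigma> q"] by simp
      also have "\<dots> = (M ** N) $ p $ q"
        by (simp add: matrix_matrix_mult_def mult.IH)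
      finally show ?thesis .
    qed
    then show ?case by blast
  qed (simp_all add: adjacency_matrix_def dual_idempotent_def adj dist mat_def inj)
  then show ?thesis by blast
qed

lemma terwilliger_algebra_reflections:
  assumes "M \<in> terwilliger_algebra adj x"
  shows "M $ reflection12 p $ reflection12 q = M $ p $ q" "M $ reflection23 p $ reflection23 q = M $ p $ q"
proof -
  have "\<forall>u. reflection12 (reflection12 u) = u \<and> reflection23 (reflection23 u) = u"
    unfolding all_vertices by (simp add: reflection12_def reflection23_def)
  then have bij: "bij reflection12" "bij reflection23"
    by (auto intro!: o_bij simp: fun_eq_iff)
  have adj: "\<forall>u v. (adj (reflection12 u) (reflection12 v) \<longleftrightarrow> adj u v) \<and> (adj (reflection23 u) (reflection23 v) \<longleftrightarrow> adj u v)"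
    unfolding all_vertices by (simp add: reflection12_def reflection23_def adj_iff cube_edges_def)
  have dist: "\<forall>u. gdist adj x (reflection12 u) = gdist adj x u \<and> gdist adj x (reflection23 u) = gdist adj x u"
    unfolding all_vertices by (simp add: reflection12_def reflection23_def)
  show "M $ reflection12 p $ reflection12 q = M $ p $ q" "M $ reflection23 p $ reflection23 q = M $ p $ q"
    using terwilliger_algebra_automorphism[OF bij(1) _ _ assms] terwilliger_algebra_automorphism[OF bij(2) _ _ assms]
      adj dist by blast+
qed

lemma reflections:
  "reflection12 x = x" "reflection12 y1 = y2" "reflection12 y2 = y1" "reflection12 y3 = y3"
  "reflection12 z1 = z2" "reflection12 z2 = z1" "reflection12 z3 = z3" "reflection12 w = w"
  "reflection23 x = x" "reflection23 y1 = y1" "reflection23 y2 = y3" "reflection23 y3 = y2"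
  "reflection23 z1 = z1" "reflection23 z2 = z3" "reflection23 z3 = z2" "reflection23 w = w"
  by (simp_all add: reflection12_def reflection23_def)

definition distance_matrix :: "nat \<Rightarrow> complex^'v^'v" where
  "distance_matrix i = (\<chi> p q. if gdist adj p q = i then 1 else 0)"

lemma A_mult_nth:
  "(A ** M) $ x $ q = M $ y1 $ q + M $ y2 $ q + M $ y3 $ q"
  "(A ** M) $ y1 $ q = M $ x $ q + M $ z2 $ q + M $ z3 $ q"
  "(A ** M) $ y2 $ q = M $ x $ q + M $ z1 $ q + M $ z3 $ q"
  "(A ** M) $ y3 $ q = M $ x $ q + M $ z1 $ q + M $ z2 $ q"
  "(A ** M) $ z1 $ q = M $ y2 $ q + M $ y3 $ q + M $ w $ q"
  "(A ** M) $ z2 $ q = M $ y1 $ q + M $ y3 $ q + M $ w $ q"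
  "(A ** M) $ z3 $ q = M $ y1 $ q + M $ y2 $ q + M $ w $ q"
  "(A ** M) $ w $ q = M $ z1 $ q + M $ z2 $ q + M $ z3 $ q"
proof -
  have "(A ** M) $ p $ q = (A *v column q M) $ p" for p
    by (simp add: matrix_matrix_mult_def matrix_vector_mult_def column_def)
  then show "(A ** M) $ x $ q = M $ y1 $ q + M $ y2 $ q + M $ y3 $ q"
    "(A ** M) $ y1 $ q = M $ x $ q + M $ z2 $ q + M $ z3 $ q"
    "(A ** M) $ y2 $ q = M $ x $ q + M $ z1 $ q + M $ z3 $ q"
    "(A ** M) $ y3 $ q = M $ x $ q + M $ z1 $ q + M $ z2 $ q"
    "(A ** M) $ z1 $ q = M $ y2 $ q + M $ y3 $ q + M $ w $ q"
    "(A ** M) $ z2 $ q = M $ y1 $ q + M $ y3 $ q + M $ w $ q"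
    "(A ** M) $ z3 $ q = M $ y1 $ q + M $ y2 $ q + M $ w $ q"
    "(A ** M) $ w $ q = M $ z1 $ q + M $ z2 $ q + M $ z3 $ q"
    by (simp_all add: column_def)
qed

text \<open>Multiplying a distance matrix by \<open>A\<close> gives a combination of the previous
  and the next one, with coefficients \<open>b\<close> and \<open>c\<close> of the array; the cube
  being bipartite, there is no middle term. As the \<open>c\<close> are nonzero, the next one can be
  solved for.\<close>

lemma distance_matrices_in_algebra:
  assumes "i \<le> 3"
  shows "distance_matrix i \<in> terwilliger_algebra adj x"
proof -
  have T: "mat 1 \<in> terwilliger_algebra adj x"
    "\<And>M N. M \<in> terwilliger_algebra adj x \<Longrightarrow> N \<in> terwilliger_algebra adj x \<Longrightarrow> M ** N \<in> terwilliger_algebra adj x"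
    "cmat.subspace (terwilliger_algebra adj x)"
    using matrix_subalgebra_terwilliger[of adj x] unfolding matrix_subalgebra_def by auto
  have "\<forall>p q. distance_matrix 0 $ p $ q = (mat 1 :: complex^'v^'v) $ p $ q"
    unfolding all_vertices by (simp add: distance_matrix_def mat_def gdist_table)
  then have 0: "distance_matrix 0 = mat 1" by (simp add: vec_eq_iff)
  have 1: "distance_matrix 1 = A"
    by (simp add: distance_matrix_def adjacency_matrix_def adj_iff_ham gdist_ham)
  have "\<forall>p q. (A ** A) $ p $ q = 3 * distance_matrix 0 $ p $ q + 2 * distance_matrix 2 $ p $ q"
    unfolding all_vertices A_mult_nth
    by (simp add: 1[symmetric] distance_matrix_def gdist_table)
  then have 2: "distance_matrix 2 = smult_matrix (1 / 2) (A ** A - smult_matrix 3 (distance_matrix 0))"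
    by (simp add: vec_eq_iff)
  have "\<forall>p q. (A ** distance_matrix 2) $ p $ q = 2 * A $ p $ q + 3 * distance_matrix 3 $ p $ q"
    unfolding all_vertices A_mult_nth
    by (simp add: 1[symmetric] distance_matrix_def gdist_table)
  then have 3: "distance_matrix 3 = smult_matrix (1 / 3) (A ** distance_matrix 2 - smult_matrix 2 A)"
    by (simp add: vec_eq_iff)
  have m0: "distance_matrix 0 \<in> terwilliger_algebra adj x" unfolding 0 by (rule T)
  have m1: "A \<in> terwilliger_algebra adj x" by (rule terwilliger_algebra_adjacency)
  have m2: "distance_matrix 2 \<in> terwilliger_algebra adj x"
    unfolding 2 by (intro cmat.subspace_scale cmat.subspace_diff T m0 m1)
  have m3: "distance_matrix 3 \<in> terwilliger_algebra adj x"
    unfolding 3 by (intro cmat.subspace_scale cmat.subspace_diff T m1 m2)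
  show ?thesis using assms m0 m1 m2 m3 1 unfolding nat_le_3_iff by metis
qed

lemma terwilliger_algebra_eq:
  "terwilliger_algebra adj x = {M. \<exists>g. \<forall>p q. M $ p $ q = g (triangle p q)}" (is "_ = ?C")
proof
  show "terwilliger_algebra adj x \<subseteq> ?C"
  proof
    fix M assume M: "M \<in> terwilliger_algebra adj x"
    have r: "M $ reflection12 p $ reflection12 q = M $ p $ q" "M $ reflection23 p $ reflection23 q = M $ p $ q" for p q
      using M by (rule terwilliger_algebra_reflections)+
    \<comment> \<open>These move the row index to one of \<open>x\<close>, \<open>y1\<close>,
      \<open>z1\<close>, \<open>w\<close>. The reflections that fix it, both of them for
      \<open>x\<close> and \<open>w\<close> and \<open>reflection23\<close> for the others, then act
      on the column index alone.\<close>
    have row: "M $ y3 $ q = M $ y2 $ reflection23 q" "M $ z3 $ q = M $ z2 $ reflection23 q"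
      "M $ y2 $ q = M $ y1 $ reflection12 q" "M $ z2 $ q = M $ z1 $ reflection12 q" for q
      using r(2)[of y3 q] r(2)[of z3 q] r(1)[of y2 q] r(1)[of z2 q] by (simp_all add: reflections)
    have column: "M $ p $ y3 = M $ p $ y2" "M $ p $ z3 = M $ p $ z2" if "p \<in> {x, y1, z1, w}" for p
      using that r(2)[of p y3] r(2)[of p z3] by (auto simp: reflections)
    have column': "M $ p $ y2 = M $ p $ y1" "M $ p $ z2 = M $ p $ z1" if "p \<in> {x, w}" for p
      using that r(1)[of p y2] r(1)[of p z2] by (auto simp: reflections)
    \<comment> \<open>Every pair is moved by reflections to a unique pair (P i, Q i j k).\<close>
    define P where "P i = (if i = 0 then x else if i = 1 then y1 else if i = 2 then z1 else w)" for i :: nat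
    \<comment> \<open>For row \<open>y1\<close> or \<open>z1\<close> the column index 1 is the equal
      or antipodal vertex, at distance 0 or 3; the indices 2 and 3 are exchanged by
      \<open>reflection23\<close> and represented by 2.\<close>
    define Q where "Q i j k =
      (if j = 0 then x
       else if j = 1 then if i = 0 \<or> i = 3 \<or> (i = 1 \<and> k = 0) \<or> (i = 2 \<and> k = 3) then y1 else y2
       else if j = 2 then if i = 0 \<or> i = 3 \<or> (i = 2 \<and> k = 0) \<or> (i = 1 \<and> k = 3) then z1 else z2
       else w)" for i j k :: nat
    have "\<forall>p q. M $ p $ q = (\<lambda>(i, j, k). M $ P i $ Q i j k) (triangle p q)"
      unfolding all_vertices triangle_def
      by (simp add: gdist_table P_def Q_def row column column' reflections)
    then have "\<exists>g. \<forall>p q. M $ p $ q = g (triangle p q)" by blast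
    then show "M \<in> ?C" by blast
  qed
  show "?C \<subseteq> terwilliger_algebra adj x"
  proof
    fix M assume "M \<in> ?C"
    then obtain g where g: "\<And>p q. M $ p $ q = g (triangle p q)" by blast
    \<comment> \<open>The product of the three matrices is the indicator of the pairs with triple
      \<open>(i, j, k)\<close>; triples that do not occur contribute the zero matrix.\<close>
    have "M = (\<Sum>(i, j, k)\<in>{0..3} \<times> {0..3} \<times> {0..3}.
        smult_matrix (g (i, j, k)) (E i ** distance_matrix k ** E j))" (is "_ = ?S")
    proof -
      have "?S $ p $ q = (\<Sum>t\<in>{0..3} \<times> {0..3} \<times> {0..3}. if triangle p q = t then g t else 0)" for p q
        unfolding cmat_sum_nth
        by (intro sum.cong) (auto simp: dual_idempotent_mult_nth distance_matrix_def triangle_def split: if_splits)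
      moreover have "triangle p q \<in> {0..3} \<times> {0..3} \<times> {0..3}" for p q
        using gdist_le_diameter[of adj] by (simp add: triangle_def)
      ultimately have "?S $ p $ q = g (triangle p q)" for p q by (simp add: sum.delta')
      then show ?thesis using g by (simp add: vec_eq_iff)
    qed
    also have "\<dots> \<in> terwilliger_algebra adj x"
      using matrix_subalgebra_terwilliger[of adj x] distance_matrices_in_algebra
        terwilliger_algebra_dual[of _ adj x]
      unfolding matrix_subalgebra_def by (auto intro!: cmat.subspace_sum cmat.subspace_scale)
    finally show "M \<in> terwilliger_algebra adj x" .
  qed
qed

lemma dim_terwilliger_algebra: "cmat.dim (terwilliger_algebra adj x) = 20"
  unfolding terwilliger_algebra_eq dim_fibre_constant_matrices card_triangle ..

end

subsection \<open>Spectra\<close>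

text \<open>This quartic is the minimal polynomial of the adjacency matrix of the cube and the
  characteristic polynomial of the 4 by 4 matrix representing it on the primary module.\<close>

lemma quartic_roots:
  fixes \<theta> :: complex
  assumes "\<theta> ^ 4 - 10 * \<theta>\<^sup>2 + 9 = 0"
  shows "\<theta> \<in> {3, 1, -1, -3}"
proof -
  have "(\<theta> - 3) * (\<theta> - 1) * (\<theta> + 1) * (\<theta> + 3) = \<theta> ^ 4 - 10 * \<theta>\<^sup>2 + 9"
    by (simp add: algebra_simps power2_eq_square power4_eq_xxxx)
  then show ?thesis using assms by (auto simp: eq_neg_iff_add_eq_0)
qed

lemma eigenvalues_B0:
  "eigenvalues (vector [vector [0, 3, 0, 0], vector [1, 0, 2, 0], vector [0, 2, 0, 1], vector [0, 0, 3, 0]]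
    :: complex^4^4) = {3, 1, -1, -3}" (is "eigenvalues ?B = _")
proof -
  have eigen: "?B *v v = \<theta> *s v \<longleftrightarrow> 3 * v $ 2 = \<theta> * v $ 1 \<and> v $ 1 + 2 * v $ 3 = \<theta> * v $ 2 \<and>
      2 * v $ 2 + v $ 4 = \<theta> * v $ 3 \<and> 3 * v $ 3 = \<theta> * v $ 4" for v \<theta>
    by (simp add: vec_eq_iff forall_4 matrix_vector_mult_def sum_4 vector_4_0)
  have "\<theta> \<in> {3, 1, -1, -3}" if "?B *v v = \<theta> *s v" "v \<noteq> 0" for v \<theta>
  proof -
    have *: "3 * v $ 2 = \<theta> * v $ 1" "v $ 1 + 2 * v $ 3 = \<theta> * v $ 2"
      "2 * v $ 2 + v $ 4 = \<theta> * v $ 3" "3 * v $ 3 = \<theta> * v $ 4"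
      using that(1) unfolding eigen by auto
    \<comment> \<open>By Cayley-Hamilton each coordinate is annihilated by the characteristic
      polynomial, so one nonzero coordinate suffices.\<close>
    have "(\<theta> ^ 4 - 10 * \<theta>\<^sup>2 + 9) * v $ 1 = 0" "(\<theta> ^ 4 - 10 * \<theta>\<^sup>2 + 9) * v $ 2 = 0"
      "(\<theta> ^ 4 - 10 * \<theta>\<^sup>2 + 9) * v $ 3 = 0" "(\<theta> ^ 4 - 10 * \<theta>\<^sup>2 + 9) * v $ 4 = 0"
      using * by algebra+
    then have "\<theta> ^ 4 - 10 * \<theta>\<^sup>2 + 9 = 0"
      using that(2) by (auto simp: vec_eq_iff forall_4)
    then show ?thesis by (rule quartic_roots)
  qed
  moreover have "\<exists>v. v \<noteq> 0 \<and> ?B *v v = \<theta> *s v" if "\<theta> \<in> {3, 1, -1, -3}" for \<theta>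
  proof -
    \<comment> \<open>The first three rows determine an eigenvector recursively from its first
      entry, where 6 clears the denominators; the last row is then the quartic equation.\<close>
    have "?B *v vector [6, 2 * \<theta>, \<theta>\<^sup>2 - 3, \<theta> ^ 3 - 7 * \<theta>] = \<theta> *s vector [6, 2 * \<theta>, \<theta>\<^sup>2 - 3, \<theta> ^ 3 - 7 * \<theta>]"
      unfolding eigen using that by auto
    moreover have "(vector [6, 2 * \<theta>, \<theta>\<^sup>2 - 3, \<theta> ^ 3 - 7 * \<theta>] :: complex^4) \<noteq> 0"
      by (simp add: vec_eq_iff forall_4)
    ultimately show ?thesis by blast
  qed
  ultimately show ?thesis unfolding eigenvalues_def by blast
qed

lemma eigenvalues_B1:
  "eigenvalues (vector [vector [0, 1], vector [1, 0]] :: complex^2^2) = {1, -1}" (is "eigenvalues ?B = _")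
proof -
  have eigen: "?B *v v = \<theta> *s v \<longleftrightarrow> v $ 2 = \<theta> * v $ 1 \<and> v $ 1 = \<theta> * v $ 2" for v \<theta>
    by (simp add: vec_eq_iff forall_2 matrix_vector_mult_def sum_2 vector_2_0)
  have "\<theta> \<in> {1, -1}" if "?B *v v = \<theta> *s v" "v \<noteq> 0" for v \<theta>
  proof -
    have "v $ 2 = \<theta> * v $ 1" "v $ 1 = \<theta> * v $ 2" using that(1)[unfolded eigen] by blast+
    then have "(\<theta>\<^sup>2 - 1) * v $ 1 = 0" "(\<theta>\<^sup>2 - 1) * v $ 2 = 0" by algebra+
    then have "\<theta>\<^sup>2 = 1" using that(2) by (auto simp: vec_eq_iff forall_2)
    then show ?thesis by (simp add: power2_eq_1_iff)
  qed
  moreover have "\<exists>v. v \<noteq> 0 \<and> ?B *v v = \<theta> *s v" if "\<theta> \<in> {1, -1}" for \<theta>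
  proof -
    have "?B *v vector [1, \<theta>] = \<theta> *s vector [1, \<theta>]" unfolding eigen using that by auto
    moreover have "(vector [1, \<theta>] :: complex^2) \<noteq> 0" by (simp add: vec_eq_iff forall_2)
    ultimately show ?thesis by blast
  qed
  ultimately show ?thesis unfolding eigenvalues_def by blast
qed

context labelled_cube
begin

lemma eigenvalue_cases:
  assumes "A *v v = \<theta> *s v" "v \<noteq> 0"
  shows "\<theta> \<in> {3, 1, -1, -3}"
proof -
  \<comment> \<open>\<open>A\<close> itself satisfies the quartic, hence so does each of its
    eigenvalues.\<close>
  have "A *v (A *v (A *v (A *v v))) = 10 *s (A *v (A *v v)) - 9 *s v"
    by (simp add: vec_eq)
  then have "\<theta> *s (\<theta> *s (\<theta> *s (\<theta> *s v))) = 10 *s (\<theta> *s (\<theta> *s v)) - 9 *s v"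
    by (simp only: assms(1) matrix_vector_smult)
  then have "(\<theta> ^ 4 - 10 * \<theta>\<^sup>2 + 9) * v $ u = 0" for u
    by (simp add: vec_eq_iff power2_eq_square power4_eq_xxxx algebra_simps)
  then have "\<theta> ^ 4 - 10 * \<theta>\<^sup>2 + 9 = 0" using assms(2) by (auto simp: vec_eq_iff)
  then show ?thesis by (rule quartic_roots)
qed

text \<open>The sign \<open>s\<close> treats 3 and -3 together: \<open>u\<close> is the all-ones
  vector for \<open>s = 1\<close> and the sign vector of the bipartition for
  \<open>s = -1\<close>.\<close>

lemma dim_eigenspace_3:
  assumes "s \<in> {1, -1}"
  shows "vec.dim (eigenspace A (3 * s)) = 1"
proof -
  define u :: "complex^'v" where "u = (\<chi> p. if gdist adj x p = 0 \<or> gdist adj x p = 2 then s else 1)"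
  have u: "u $ p = (if gdist adj x p = 0 \<or> gdist adj x p = 2 then s else 1)" for p by (simp add: u_def)
  have "u \<noteq> 0" by (simp add: vec_eq u)
  show ?thesis
  proof (rule vec.dim_unique[of "{u}"])
    show "{u} \<subseteq> eigenspace A (3 * s)" using assms by (auto simp: eigenspace_def vec_eq u)
    show "eigenspace A (3 * s) \<subseteq> vec.span {u}"
    proof
      fix v assume "v \<in> eigenspace A (3 * s)"
      then have v: "A *v v = (3 * s) *s v" by (simp add: eigenspace_def)
      have eqs: "v $ y1 + v $ y2 + v $ y3 = 3 * s * v $ x" "v $ x + v $ z2 + v $ z3 = 3 * s * v $ y1"
        "v $ x + v $ z1 + v $ z3 = 3 * s * v $ y2" "v $ x + v $ z1 + v $ z2 = 3 * s * v $ y3"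
        "v $ y2 + v $ y3 + v $ w = 3 * s * v $ z1" "v $ y1 + v $ y3 + v $ w = 3 * s * v $ z2"
        "v $ y1 + v $ y2 + v $ w = 3 * s * v $ z3" "v $ z1 + v $ z2 + v $ z3 = 3 * s * v $ w"
        using v unfolding vec_eq by simp_all
      have "s = 1 \<or> s = -1" using assms by blast
      then have "v $ x = s * v $ y1" "v $ y2 = v $ y1" "v $ y3 = v $ y1"
        "v $ z1 = s * v $ y1" "v $ z2 = s * v $ y1" "v $ z3 = s * v $ y1" "v $ w = v $ y1"
        using eqs by algebra+
      then have "v = v $ y1 *s u" unfolding vec_eq by (simp add: u)
      then show "v \<in> vec.span {u}" by (metis vec.span_base vec.span_scale singletonI)
    qed
  qed (use \<open>u \<noteq> 0\<close> in auto)
qed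

lemma dim_eigenspace_1:
  assumes "s \<in> {1, -1}"
  shows "vec.dim (eigenspace A s) = 3"
proof -
  \<comment> \<open>An eigenvector is determined by its values on the first layer. For antipodal
    \<open>y\<close> and \<open>z\<close>, \<open>u y z\<close> has there the value 1 at
    \<open>y\<close> and 0 elsewhere, which makes \<open>y1\<close>, \<open>y2\<close>,
    \<open>y3\<close> the pivots.\<close>
  define u :: "'v \<Rightarrow> 'v \<Rightarrow> complex^'v" where
    "u y z = (\<chi> p. if p = x then s else if p = w then -1 else if p = y then 1 else if p = z then -s else 0)" for y z
  have u: "u y z $ p = (if p = x then s else if p = w then -1 else if p = y then 1 else if p = z then -s else 0)" for y z p
    by (simp add: u_def)
  let ?B = "{u y1 z1, u y2 z2, u y3 z3}"
  have neqs: "u y1 z1 \<noteq> u y2 z2" "u y1 z1 \<noteq> u y3 z3" "u y2 z2 \<noteq> u y3 z3" by (auto simp: vec_eq u)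
  show ?thesis
  proof (rule vec.dim_unique[of ?B])
    show "?B \<subseteq> eigenspace A s" using assms by (auto simp: eigenspace_def vec_eq u)
    show "eigenspace A s \<subseteq> vec.span ?B"
    proof
      fix v assume "v \<in> eigenspace A s"
      then have v: "A *v v = s *s v" by (simp add: eigenspace_def)
      have eqs: "v $ y1 + v $ y2 + v $ y3 = s * v $ x" "v $ x + v $ z2 + v $ z3 = s * v $ y1"
        "v $ x + v $ z1 + v $ z3 = s * v $ y2" "v $ x + v $ z1 + v $ z2 = s * v $ y3"
        "v $ z1 + v $ z2 + v $ z3 = s * v $ w"
        using v unfolding vec_eq by simp_all
      have "s = 1 \<or> s = -1" using assms by blast
      then have "v $ x = s * v $ y1 + s * v $ y2 + s * v $ y3"
        "v $ z1 = - s * v $ y1" "v $ z2 = - s * v $ y2" "v $ z3 = - s * v $ y3"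
        "v $ w = - v $ y1 - v $ y2 - v $ y3"
        using eqs by algebra+
      then have "v = v $ y1 *s u y1 z1 + v $ y2 *s u y2 z2 + v $ y3 *s u y3 z3"
        unfolding vec_eq by (simp add: u)
      also have "\<dots> \<in> vec.span ?B" by (intro vec.span_add vec.span_scale vec.span_base) auto
      finally show "v \<in> vec.span ?B" .
    qed
    show "vec.independent ?B"
    proof (rule independent_pivots)
      show "\<exists>p. b $ p \<noteq> 0 \<and> (\<forall>b'\<in>?B - {b}. b' $ p = 0)" if "b \<in> ?B" for b
        using that
      proof (elim insertE emptyE; hypsubst)
        show "\<exists>p. u y1 z1 $ p \<noteq> 0 \<and> (\<forall>b'\<in>?B - {u y1 z1}. b' $ p = 0)"
          by (rule exI[of _ y1]) (auto simp: u)
        show "\<exists>p. u y2 z2 $ p \<noteq> 0 \<and> (\<forall>b'\<in>?B - {u y2 z2}. b' $ p = 0)"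
          by (rule exI[of _ y2]) (auto simp: u)
        show "\<exists>p. u y3 z3 $ p \<noteq> 0 \<and> (\<forall>b'\<in>?B - {u y3 z3}. b' $ p = 0)"
          by (rule exI[of _ y3]) (auto simp: u)
      qed
    qed simp
  qed (use neqs in simp)
qed

lemma spectrum: "spectrum A = {(3, 1), (1, 3), (-1, 3), (-3, 1)}"
proof -
  have dims: "vec.dim (eigenspace A 3) = 1" "vec.dim (eigenspace A 1) = 3"
    "vec.dim (eigenspace A (-1)) = 3" "vec.dim (eigenspace A (-3)) = 1"
    using dim_eigenspace_3[of 1] dim_eigenspace_3[of "-1"] dim_eigenspace_1[of 1] dim_eigenspace_1[of "-1"]
    by simp_all
  \<comment> \<open>A nonzero dimension already certifies an eigenvalue, so no further eigenvectors
    have to be exhibited.\<close>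
  have *: "\<theta> \<in> eigenvalues A" if "vec.dim (eigenspace A \<theta>) \<noteq> 0" for \<theta>
  proof -
    have "eigenspace A \<theta> \<noteq> {0}" using that by auto
    moreover have "0 \<in> eigenspace A \<theta>" by (simp add: eigenspace_def)
    ultimately show ?thesis by (auto simp: eigenvalues_def eigenspace_def)
  qed
  have "{3, 1, -1, -3} \<subseteq> eigenvalues A"
    using *[of 3] *[of 1] *[of "-1"] *[of "-3"] unfolding dims by simp
  moreover have "eigenvalues A \<subseteq> {3, 1, -1, -3}"
    using eigenvalue_cases by (auto simp: eigenvalues_def)
  ultimately have "eigenvalues A = {3, 1, -1, -3}" by (rule subset_antisym[rotated])
  then have "spectrum A = (\<lambda>\<theta>. (\<theta>, vec.dim (eigenspace A \<theta>))) ` {3, 1, -1, -3}"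
    by (auto simp: spectrum_def)
  then show ?thesis using dims by simp
qed

lemma W1_properties:
  assumes \<nu>: "\<nu> \<in> seeds" "\<nu> \<noteq> 0"
  shows "endpoint adj x (W1 \<nu>) = 1 \<and>
    multiplicity_of adj x (W1 \<nu>) = 2 \<and>
    vec.dim (W1 \<nu>) = 2 \<and>
    module_diameter adj x (W1 \<nu>) = 1 \<and>
    shape adj x (W1 \<nu>) = [1, 1] \<and>
    pure_vector adj x 1 \<nu> \<and>
    module_layer adj x (W1 \<nu>) 1 = vec.span {\<nu>} \<and>
    vec.dim (module_layer adj x (W1 \<nu>) 1) = 1 \<and>
    A *v \<nu> = E 2 *v (A *v \<nu>) \<and>
    pure_basis adj x [\<nu>, A *v \<nu>] (W1 \<nu>) \<and>
    represents A [\<nu>, A *v \<nu>] (vector [vector [0, 1], vector [1, 0]] :: complex^2^2)"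
  using endpoint_W1[OF \<nu>] multiplicity_W1[OF decomposition \<nu>] dim_W1[OF \<nu>] module_diameter_W1[OF \<nu>]
    shape_W1[OF \<nu>] pure_vector_seed(1)[OF \<nu>] module_layer_W1[OF \<nu>, of 1] dim_span_single[OF \<nu>(2)]
    E_seed(2)[OF \<nu>, of 2] pure_basis_W1[OF \<nu>] represents_W1[OF \<nu>]
  by simp

lemma seed_modules:
  "\<forall>(W, \<nu>) \<in> {(W1 seed_a, seed_a), (W1 seed_b, seed_b)}.
     endpoint adj x W = 1 \<and>
     multiplicity_of adj x W = 2 \<and>
     vec.dim W = 2 \<and>
     module_diameter adj x W = 1 \<and>
     shape adj x W = [1, 1] \<and>
     pure_vector adj x 1 \<nu> \<and>
     module_layer adj x W 1 = vec.span {\<nu>} \<and>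
     vec.dim (module_layer adj x W 1) = 1 \<and>
     A *v \<nu> = E 2 *v (A *v \<nu>) \<and>
     pure_basis adj x [\<nu>, A *v \<nu>] W \<and>
     represents A [\<nu>, A *v \<nu>] (vector [vector [0, 1], vector [1, 0]] :: complex^2^2)"
  using W1_properties[OF seed_a] W1_properties[OF seed_b]
    dim_span_single[OF seed_a(2)] dim_span_single[OF seed_b(2)]
  by (simp only: ball_simps prod.case simp_thms)

end

theorem mainTheorem4:
  fixes adj :: "'v::finite \<Rightarrow> 'v \<Rightarrow> bool"
  assumes "connected_simple_graph adj"
  shows
    "(is_3cube adj \<longleftrightarrow>
        distance_regular adj \<and> CARD('v) = 8 \<and> intersection_array adj = ([3, 2, 1], [1, 2, 3])) \<and>
     (is_3cube adj \<longrightarrow>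
        spectrum (adjacency_matrix adj) = {(3, 1), (1, 3), (-1, 3), (-3, 1)} \<and>
        (\<forall>x ys. distinct ys \<and> set ys = layer adj x 1 \<longrightarrow>
          (let A = adjacency_matrix adj;
               e = layer_vector adj x;
               B0 = vector [vector [0, 3, 0, 0],
                            vector [1, 0, 2, 0],
                            vector [0, 2, 0, 1],
                            vector [0, 0, 3, 0]] :: complex^4^4;
               B1 = vector [vector [0, 1],
                            vector [1, 0]] :: complex^2^2
           in
           (\<exists>W0 W1a W1b \<nu>a \<nu>b.
              distinct [W0, W1a, W1b] \<and>
              orthogonal_decomposition adj x {W0, W1a, W1b} \<and>
              \<not> T_isomorphic adj x W0 W1a \<and>
              \<not> T_isomorphic adj x W0 W1b \<and>
              T_isomorphic adj x W1a W1b \<and>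
              \<comment> \<open>type I\<close>
              endpoint adj x W0 = 0 \<and>
              multiplicity_of adj x W0 = 1 \<and>
              vec.dim W0 = 4 \<and>
              module_diameter adj x W0 = 3 \<and>
              shape adj x W0 = [1, 1, 1, 1] \<and>
              pure_basis adj x [e 0, e 1, e 2, e 3] W0 \<and>
              represents A [e 0, e 1, e 2, e 3] B0 \<and>
              eigenvalues B0 = {3, 1, -1, -3} \<and>
              \<comment> \<open>type II\<close>
              essential_part ys \<nu>a = [1, -1, 0] \<and>
              essential_part ys \<nu>b = [1, 1, -2] \<and>
              (\<forall>(W, \<nu>) \<in> {(W1a, \<nu>a), (W1b, \<nu>b)}.
                 endpoint adj x W = 1 \<and>
                 multiplicity_of adj x W = 2 \<and>
                 vec.dim W = 2 \<and>
                 module_diameter adj x W = 1 \<and>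
                 shape adj x W = [1, 1] \<and>
                 pure_vector adj x 1 \<nu> \<and>
                 module_layer adj x W 1 = vec.span {\<nu>} \<and>
                 vec.dim (module_layer adj x W 1) = 1 \<and>
                 A *v \<nu> = dual_idempotent adj x 2 *v (A *v \<nu>) \<and>
                 pure_basis adj x [\<nu>, A *v \<nu>] W \<and>
                 represents A [\<nu>, A *v \<nu>] B1) \<and>
              eigenvalues B1 = {1, -1}) \<and>
           cmat.dim (terwilliger_algebra adj x) = 4^2 + 2^2 \<and>
           cmat.dim (terwilliger_algebra adj x) = 20)))"
  unfolding Let_def
proof (intro conjI impI allI, goal_cases)
  case 1
  show ?case using assms by (rule is_3cube_iff)
next
  case 2
  then show ?case using is_3cube_labelled labelled_cube.spectrum by blast
next
  case (3 x ys)
  \<comment> \<open>\<open>is_3cube_labelled\<close> leaves the order of the neighbours open; the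
    route through the intersection array names them in the order of \<open>ys\<close>, as the
    essential parts require.\<close>
  then obtain y1 y2 y3 z1 z2 z3 w where y: "ys = [y1, y2, y3]"
    and "labelled_cube adj x y1 y2 y3 z1 z2 z3 w"
    using distance_regular_labelled[OF assms] is_3cube_distance_regular by metis
  then interpret labelled_cube adj x y1 y2 y3 z1 z2 z3 w by simp
  have essential: "essential_part ys seed_a = [1, -1, 0]" "essential_part ys seed_b = [1, 1, -2]"
    by (simp_all add: y essential_part_def)
  show ?case
    by (rule exI[of _ W0], rule exI[of _ "W1 seed_a"], rule exI[of _ "W1 seed_b"],
        rule exI[of _ seed_a], rule exI[of _ seed_b], intro conjI)
      (fact distinct_modules decomposition not_isomorphic_W0_W1[OF seed_a] not_isomorphic_W0_W1[OF seed_b]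
        isomorphic_W1[OF seed_a seed_b] endpoint_W0 multiplicity_W0[OF decomposition] dim_W0
        module_diameter_W0 shape_W0 pure_basis_W0 represents_W0 eigenvalues_B0 essential seed_modules
        eigenvalues_B1)+
next
  case (4 x)
  then show ?case using is_3cube_labelled labelled_cube.dim_terwilliger_algebra by fastforce
next
  case (5 x)
  then show ?case using is_3cube_labelled labelled_cube.dim_terwilliger_algebra by fastforce
qed

end
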